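(* Let $\Delta=(\mathcal{C},\delta)$ be a building of type $(W,S)$ and let $(\mathcal{G},\Lambda)$ be a graph of special subgroups of $(W,S)$ with subsets $S_\lambda\subseteq S$. Then the following are equivalent: (i) $(\mathcal{G},\Lambda)$ is a visual graph of groups decomposition of $(W,S)$; (ii) $S=\bigcup_{v\in\mathscr{V}(\Lambda)}S_v$ and $\Gamma^\Delta_{(\mathcal{G},\Lambda)}(\mathcal{C})$ is a tree.
   Context: $(W,S)$ is a Coxeter group, $S$ finite, $W_J=\langle J\rangle$. For a building $\Delta=(\mathcal{C},\delta)$ of type $(W,S)$ and $J\subseteq S$, $\mathrm{Res}_J(c)=\{d\in\mathcal{C}\mid\delta(c,d)\in W_J\}$. A graph of special subgroups $(\mathcal{G},\Lambda)$ is based on a connected graph $\Lambda$ in Serre's sense (vertex set $\mathscr{V}(\Lambda)$, edge set $\mathscr{E}(\Lambda)$ with origin $o$, terminus $t$, involution $e\mapsto\bar e$), assigning to each $\lambda\in\mathscr{V}(\Lambda)\sqcup\mathscr{E}(\Lambda)$ a subset $S_\lambda\subseteq S$ with group $\mathcal{G}_\lambda=W_{S_\lambda}$, where $S_e=S_{\bar e}\subseteq S_{t(e)}$ and edge monomorphisms $\mathcal{G}_e\hookrightarrow\mathcal{G}_{t(e)}$ are inclusions. It is a visual graph of groups decomposition of $(W,S)$ if the homomorphism $\pi_1(\mathcal{G},\Lambda)\to W$ induced by the inclusions $W_{S_\lambda}\hookrightarrow W$ is an isomorphism. The graph $\Gamma^\Delta_{(\mathcal{G},\Lambda)}(\mathcal{C})$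 is the Serre graph with vertex set $\bigsqcup_{v\in\mathscr{V}(\Lambda)}\{\mathrm{Res}_{S_v}(c)\mid c\in\mathcal{C}\}$ and edge set $\bigsqcup_{e\in\mathscr{E}(\Lambda)}\{\mathrm{Res}_{S_e}(c)\mid c\in\mathcal{C}\}$ (copies for $e$ and $\bar e$ are disjoint), with $\overline{\mathrm{Res}_{S_e}(c)}=\mathrm{Res}_{S_{\bar e}}(c)$, $o(\mathrm{Res}_{S_e}(c))=\mathrm{Res}_{S_{o(e)}}(c)$, $t(\mathrm{Res}_{S_e}(c))=\mathrm{Res}_{S_{t(e)}}(c)$. A tree is a connected nonempty Serre graph without circuits. *)

theory Defs
  imports "HOL-Algebra.Generated_Groups"
begin

definition wprod :: "('a, 'b) monoid_scheme \<Rightarrow> 'a list \<Rightarrow> 'a" where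
  "wprod G ws = foldr (\<lambda>x y. x \<otimes>\<^bsub>G\<^esub> y) ws \<one>\<^bsub>G\<^esub>"

text \<open>Congruence on words over the alphabet X generated by the equations in R
  (the monoid presented by X and R; when every generator is invertible modulo R this is
  the group presented by X and R).\<close>
inductive pres_eq :: "'x set \<Rightarrow> ('x list \<times> 'x list) set \<Rightarrow> 'x list \<Rightarrow> 'x list \<Rightarrow> bool"
  for X R where
  refl: "w \<in> lists X \<Longrightarrow> pres_eq X R w w"
| rel: "(l, r) \<in> R \<Longrightarrow> u \<in> lists X \<Longrightarrow> v \<in> lists X \<Longrightarrow> pres_eq X R (u @ l @ v) (u @ r @ v)"
| sym: "pres_eq X R a b \<Longrightarrow> pres_eq X R b a"
| trans: "pres_eq X R a b \<Longrightarrow> pres_eq X R b c \<Longrightarrow> pres_eq X R a c"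

text \<open>Coxeter relators (s t)^(m s t); the entry 0 encodes m = infinity (no relation).\<close>
definition coxeter_relators :: "'a set \<Rightarrow> ('a \<Rightarrow> 'a \<Rightarrow> nat) \<Rightarrow> ('a list \<times> 'a list) set" where
  "coxeter_relators S m =
     {(concat (replicate (m s t) [s, t]), []) | s t. s \<in> S \<and> t \<in> S \<and> m s t \<noteq> 0}"

definition coxeter_matrix :: "'a set \<Rightarrow> ('a \<Rightarrow> 'a \<Rightarrow> nat) \<Rightarrow> bool" where
  "coxeter_matrix S m \<longleftrightarrow> (\<forall>s\<in>S. m s s = 1) \<and>
     (\<forall>s\<in>S. \<forall>t\<in>S. s \<noteq> t \<longrightarrow> m s t = m t s \<and> m s t \<noteq> 1)"

definition coxeter_system :: "('a, 'b) monoid_scheme \<Rightarrow> 'a set \<Rightarrow> bool" where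
  "coxeter_system W S \<longleftrightarrow> group W \<and> S \<subseteq> carrier W \<and> finite S \<and>
     (\<forall>w\<in>carrier W. \<exists>ws\<in>lists S. wprod W ws = w) \<and>
     (\<exists>m. coxeter_matrix S m \<and>
        (\<forall>ws\<in>lists S. wprod W ws = \<one>\<^bsub>W\<^esub> \<longleftrightarrow> pres_eq S (coxeter_relators S m) ws []))"

definition cox_length :: "('a, 'b) monoid_scheme \<Rightarrow> 'a set \<Rightarrow> 'a \<Rightarrow> nat" where
  "cox_length W S w = (LEAST n. \<exists>ws\<in>lists S. length ws = n \<and> wprod W ws = w)"

section \<open>Buildings (W-metric definition, Abramenko--Brown 5.1)\<close>

definition building :: "('a, 'b) monoid_scheme \<Rightarrow> 'a set \<Rightarrow> 'c set \<Rightarrow> ('c \<Rightarrow> 'c \<Rightarrow> 'a) \<Rightarrow> bool" where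
  "building W S C \<delta> \<longleftrightarrow> C \<noteq> {} \<and>
     (\<forall>c\<in>C. \<forall>d\<in>C. \<delta> c d \<in> carrier W) \<and>
     (\<forall>c\<in>C. \<forall>d\<in>C. \<delta> c d = \<one>\<^bsub>W\<^esub> \<longleftrightarrow> c = d) \<and>
     (\<forall>c\<in>C. \<forall>d\<in>C. \<forall>c'\<in>C. \<forall>s\<in>S. \<delta> c' c = s \<longrightarrow>
        (\<delta> c' d = s \<otimes>\<^bsub>W\<^esub> \<delta> c d \<or> \<delta> c' d = \<delta> c d) \<and>
        (cox_length W S (s \<otimes>\<^bsub>W\<^esub> \<delta> c d) = cox_length W S (\<delta> c d) + 1
           \<longrightarrow> \<delta> c' d = s \<otimes>\<^bsub>W\<^esub> \<delta> c d)) \<and>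
     (\<forall>c\<in>C. \<forall>d\<in>C. \<forall>s\<in>S. \<exists>c'\<in>C. \<delta> c' c = s \<and> \<delta> c' d = s \<otimes>\<^bsub>W\<^esub> \<delta> c d)"

definition residue :: "('a, 'b) monoid_scheme \<Rightarrow> 'c set \<Rightarrow> ('c \<Rightarrow> 'c \<Rightarrow> 'a) \<Rightarrow> 'a set \<Rightarrow> 'c \<Rightarrow> 'c set" where
  "residue W C \<delta> J c = {d\<in>C. \<delta> c d \<in> generate W J}"

definition serre_graph :: "'v set \<Rightarrow> 'e set \<Rightarrow> ('e \<Rightarrow> 'v) \<Rightarrow> ('e \<Rightarrow> 'v) \<Rightarrow> ('e \<Rightarrow> 'e) \<Rightarrow> bool" where
  "serre_graph V E org t rv \<longleftrightarrow> (\<forall>e\<in>E. org e \<in> V \<and> t e \<in> V \<and> rv e \<in> E \<and>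
      rv (rv e) = e \<and> rv e \<noteq> e \<and> org (rv e) = t e)"

fun walk :: "('e \<Rightarrow> 'v) \<Rightarrow> ('e \<Rightarrow> 'v) \<Rightarrow> 'e list \<Rightarrow> 'v \<Rightarrow> 'v \<Rightarrow> bool" where
  "walk org t [] x y \<longleftrightarrow> x = y"
| "walk org t (e # p) x y \<longleftrightarrow> org e = x \<and> walk org t p (t e) y"

definition serre_connected :: "'v set \<Rightarrow> 'e set \<Rightarrow> ('e \<Rightarrow> 'v) \<Rightarrow> ('e \<Rightarrow> 'v) \<Rightarrow> bool" where
  "serre_connected V E org t \<longleftrightarrow> V \<noteq> {} \<and>
     (\<forall>x\<in>V. \<forall>y\<in>V. \<exists>p\<in>lists E. walk org t p x y)"

text \<open>A circuit (a subgraph isomorphic to Circ_n, n >= 1): a closed path e_1 ... e_n with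
  pairwise distinct vertices and without (cyclic) backtracking.\<close>
definition has_circuit :: "'e set \<Rightarrow> ('e \<Rightarrow> 'v) \<Rightarrow> ('e \<Rightarrow> 'v) \<Rightarrow> ('e \<Rightarrow> 'e) \<Rightarrow> bool" where
  "has_circuit E org t rv \<longleftrightarrow> (\<exists>p. p \<noteq> [] \<and> p \<in> lists E \<and> walk org t p (org (hd p)) (org (hd p)) \<and>
      distinct (map org p) \<and>
      (\<forall>i<length p. p ! ((i + 1) mod length p) \<noteq> rv (p ! i)))"

definition serre_tree :: "'v set \<Rightarrow> 'e set \<Rightarrow> ('e \<Rightarrow> 'v) \<Rightarrow> ('e \<Rightarrow> 'v) \<Rightarrow> ('e \<Rightarrow> 'e) \<Rightarrow> bool" where
  "serre_tree V E org t rv \<longleftrightarrow> serre_graph V E org t rv \<and> serre_connected V E org t \<and>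
     \<not> has_circuit E org t rv"

definition maximal_tree :: "'v set \<Rightarrow> 'e set \<Rightarrow> ('e \<Rightarrow> 'v) \<Rightarrow> ('e \<Rightarrow> 'v) \<Rightarrow> ('e \<Rightarrow> 'e) \<Rightarrow> 'e set \<Rightarrow> bool" where
  "maximal_tree V E org t rv T \<longleftrightarrow> T \<subseteq> E \<and> serre_tree V T org t rv"

definition graph_of_special_subgroups ::
  "('a, 'b) monoid_scheme \<Rightarrow> 'a set \<Rightarrow> 'v set \<Rightarrow> 'e set \<Rightarrow> ('e \<Rightarrow> 'v) \<Rightarrow> ('e \<Rightarrow> 'v) \<Rightarrow> ('e \<Rightarrow> 'e)
   \<Rightarrow> ('v \<Rightarrow> 'a set) \<Rightarrow> ('e \<Rightarrow> 'a set) \<Rightarrow> bool" where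
  "graph_of_special_subgroups W S V E org t rv SV SE \<longleftrightarrow>
     serre_graph V E org t rv \<and> serre_connected V E org t \<and>
     (\<forall>v\<in>V. SV v \<subseteq> S) \<and>
     (\<forall>e\<in>E. SE e \<subseteq> S \<and> SE (rv e) = SE e \<and> SE e \<subseteq> SV (t e))"

datatype ('v, 'e, 'a) gog_letter = VL 'v 'a | EL 'e

definition gog_gens ::
  "('a, 'b) monoid_scheme \<Rightarrow> 'v set \<Rightarrow> 'e set \<Rightarrow> ('v \<Rightarrow> 'a set) \<Rightarrow> ('v, 'e, 'a) gog_letter set" where
  "gog_gens W V E SV = {VL v g | v g. v \<in> V \<and> g \<in> generate W (SV v)} \<union> {EL e | e. e \<in> E}"

text \<open>Defining relations of pi_1(G,Lambda,T) (Serre, Trees, I.5.1): the multiplication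
  tables of the vertex groups, t_(rev e) = t_e^(-1), t_e a t_e^(-1) = a for a in G_e
  (the edge monomorphisms being inclusions), and t_e = 1 for edges e of the maximal tree T.\<close>
definition gog_relations ::
  "('a, 'b) monoid_scheme \<Rightarrow> 'v set \<Rightarrow> 'e set \<Rightarrow> ('e \<Rightarrow> 'v) \<Rightarrow> ('e \<Rightarrow> 'v) \<Rightarrow> ('e \<Rightarrow> 'e)
   \<Rightarrow> ('v \<Rightarrow> 'a set) \<Rightarrow> ('e \<Rightarrow> 'a set) \<Rightarrow> 'e set \<Rightarrow> (('v, 'e, 'a) gog_letter list \<times> ('v, 'e, 'a) gog_letter list) set" where
  "gog_relations W V E org t rv SV SE T =
     {([VL v g, VL v h], [VL v (g \<otimes>\<^bsub>W\<^esub> h)]) | v g h.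
         v \<in> V \<and> g \<in> generate W (SV v) \<and> h \<in> generate W (SV v)}
   \<union> {([VL v \<one>\<^bsub>W\<^esub>], []) | v. v \<in> V}
   \<union> {([EL e, EL (rv e)], []) | e. e \<in> E}
   \<union> {([EL e, VL (t e) a, EL (rv e)], [VL (org e) a]) | e a. e \<in> E \<and> a \<in> generate W (SE e)}
   \<union> {([EL e], []) | e. e \<in> T}"

text \<open>The homomorphism pi_1(G,Lambda) -> W induced by the inclusions (t_e maps to 1).\<close>
fun gog_eval :: "('a, 'b) monoid_scheme \<Rightarrow> ('v, 'e, 'a) gog_letter \<Rightarrow> 'a" where
  "gog_eval W (VL v g) = g"
| "gog_eval W (EL e) = \<one>\<^bsub>W\<^esub>"

definition visual_decomposition ::
  "('a, 'b) monoid_scheme \<Rightarrow> 'a set \<Rightarrow> 'v set \<Rightarrow> 'e set \<Rightarrow> ('e \<Rightarrow> 'v) \<Rightarrow> ('e \<Rightarrow> 'v) \<Rightarrow> ('e \<Rightarrow> 'e)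
   \<Rightarrow> ('v \<Rightarrow> 'a set) \<Rightarrow> ('e \<Rightarrow> 'a set) \<Rightarrow> bool" where
  "visual_decomposition W S V E org t rv SV SE \<longleftrightarrow>
     graph_of_special_subgroups W S V E org t rv SV SE \<and>
     (\<exists>T. maximal_tree V E org t rv T \<and>
        (\<forall>w\<in>carrier W. \<exists>u\<in>lists (gog_gens W V E SV). wprod W (map (gog_eval W) u) = w) \<and>
        (\<forall>u\<in>lists (gog_gens W V E SV). \<forall>u'\<in>lists (gog_gens W V E SV).
           wprod W (map (gog_eval W) u) = wprod W (map (gog_eval W) u') \<longrightarrow>
           pres_eq (gog_gens W V E SV) (gog_relations W V E org t rv SV SE T) u u'))"

definition res_graph_V ::
  "('a, 'b) monoid_scheme \<Rightarrow> 'c set \<Rightarrow> ('c \<Rightarrow> 'c \<Rightarrow> 'a) \<Rightarrow> 'v set \<Rightarrow> ('v \<Rightarrow> 'a set) \<Rightarrow> ('v \<times> 'c set) set" where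
  "res_graph_V W C \<delta> V SV = {(v, residue W C \<delta> (SV v) c) | v c. v \<in> V \<and> c \<in> C}"

definition res_graph_E ::
  "('a, 'b) monoid_scheme \<Rightarrow> 'c set \<Rightarrow> ('c \<Rightarrow> 'c \<Rightarrow> 'a) \<Rightarrow> 'e set \<Rightarrow> ('e \<Rightarrow> 'a set) \<Rightarrow> ('e \<times> 'c set) set" where
  "res_graph_E W C \<delta> E SE = {(e, residue W C \<delta> (SE e) c) | e c. e \<in> E \<and> c \<in> C}"

text \<open>org(Res_{S_e}(c)) = Res_{S_o(e)}(c), for any chamber c of the residue (well defined).\<close>
definition res_graph_o ::
  "('a, 'b) monoid_scheme \<Rightarrow> 'c set \<Rightarrow> ('c \<Rightarrow> 'c \<Rightarrow> 'a) \<Rightarrow> ('e \<Rightarrow> 'v) \<Rightarrow> ('v \<Rightarrow> 'a set)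
   \<Rightarrow> ('e \<times> 'c set) \<Rightarrow> ('v \<times> 'c set)" where
  "res_graph_o W C \<delta> org SV x = (org (fst x), residue W C \<delta> (SV (org (fst x))) (SOME c. c \<in> snd x))"

definition res_graph_rev :: "('e \<Rightarrow> 'e) \<Rightarrow> ('e \<times> 'c set) \<Rightarrow> ('e \<times> 'c set)" where
  "res_graph_rev rv x = (rv (fst x), snd x)"

end

theory Submission
  imports Defs
begin

text \<open>
  A connected graph is a tree iff for each edge \<open>x\<close> there is an integer function on the vertices
  that jumps by one across \<open>x\<close> and is constant across every other edge.

  Suppose that the fundamental group is \<open>W\<close>. Signed crossing numbers with a fixed edge
  \<open>x = (e0, Res(c0))\<close>, taken along the walks spelled by words in the generators, are invariant under the
  defining relations, hence depend only on the element of \<open>W\<close>; this gives such a function on the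
  residue graph of \<open>W\<close>. It is pulled back along the retraction \<open>c \<mapsto> \<delta>(c, c0)\<^sup>-\<^sup>1\<close>, under
  which only \<open>x\<close> itself lies over the edge of the identity coset.

  Conversely, if the residue graph is a tree, so is the base graph, because it embeds at every chamber. The
  vertices whose group contains a given \<open>s\<close> form a connected subgraph, and every pair \<open>s, s'\<close> with
  \<open>m(s, s')\<close> finite lies in a common vertex group. Thus sending \<open>s\<close> to its copy in any vertex group
  respects the Coxeter relations and inverts the homomorphism to \<open>W\<close>.
\<close>

section \<open>Walks, circuits and potentials\<close>

lemma walk_append:
  "walk org t (p @ q) x y \<longleftrightarrow> (\<exists>z. walk org t p x z \<and> walk org t q z y)"
  by (induction p arbitrary: x) auto

lemma walk_closed_hd: "walk org t p x x \<Longrightarrow> p \<noteq> [] \<Longrightarrow> org (hd p) = x"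
  by (cases p) auto

text \<open>Telescoping: on the edges of the walk \<open>\<chi>\<close> is the coboundary of
  \<open>\<phi>\<close>.\<close>

lemma walk_sum_diff:
  fixes \<phi> :: "'v \<Rightarrow> int"
  assumes "walk org t p x y" "\<And>e. e \<in> set p \<Longrightarrow> \<phi> (t e) - \<phi> (org e) = \<chi> e"
  shows "sum_list (map \<chi> p) = \<phi> y - \<phi> x"
  using assms
proof (induction p arbitrary: x)
  case (Cons e p)
  have "sum_list (map \<chi> p) = \<phi> y - \<phi> (t e)"
    using Cons.prems by (intro Cons.IH) auto
  moreover have "\<phi> (t e) - \<phi> x = \<chi> e"
    using Cons.prems by auto
  ultimately show ?case by simp
qed auto

lemma serre_graph_t_rv:
  "serre_graph V E org t rv \<Longrightarrow> e \<in> E \<Longrightarrow> t (rv e) = org e"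
  unfolding serre_graph_def by metis

text \<open>Induction on the length. If an origin repeats, the closed walk splits into two shorter
  ones. Otherwise the absence of circuits forces a cyclic backtrack, whose two edges cancel by
  antisymmetry.\<close>

lemma closed_walk_sum_zero:
  fixes \<chi> :: "'e \<Rightarrow> int"
  assumes G: "serre_graph V E org t rv" and nc: "\<not> has_circuit E org t rv"
    and anti: "\<And>e. e \<in> E \<Longrightarrow> \<chi> (rv e) = - \<chi> e"
  shows "p \<in> lists E \<Longrightarrow> walk org t p x x \<Longrightarrow> sum_list (map \<chi> p) = 0"
proof (induction "length p" arbitrary: p x rule: less_induct)
  case less
  show ?case
  proof (cases "p = []")
    case False
    have hd: "org (hd p) = x"
      using less.prems False by (auto intro: walk_closed_hd)
    show ?thesis
    proof (cases "distinct (map org p)")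
      case False
      then obtain xs y ys zs where "map org p = xs @ [y] @ ys @ [y] @ zs"
        using not_distinct_decomp by blast
      then have "map org p = xs @ (y # ys) @ (y # zs)" by simp
      then obtain a bc where p: "p = a @ bc" and a: "map org a = xs"
          and bc: "map org bc = (y # ys) @ (y # zs)"
        by (metis map_eq_append_conv)
      obtain b c where bc: "bc = b @ c" and b: "map org b = y # ys" and c: "map org c = y # zs"
        using bc by (metis map_eq_append_conv)
      note p = p[unfolded bc]
      obtain z1 z2 where w: "walk org t a x z1" "walk org t b z1 z2" "walk org t c z2 x"
        using less.prems by (auto simp: p walk_append)
      have z: "z1 = y"
        using w(2) b by (cases b) auto
      have z': "z2 = y"
        using w(3) c by (cases c) auto
      note z = z z'
      have ne: "b \<noteq> []" "c \<noteq> []" using b c by auto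
      have "sum_list (map \<chi> b) = 0"
        using less.hyps[of b y] w z less.prems ne by (simp add: p)
      moreover have "sum_list (map \<chi> (a @ c)) = 0"
      proof (rule less.hyps)
        show "walk org t (a @ c) x x" using w z by (auto simp: walk_append)
      qed (use less.prems ne in \<open>auto simp: p\<close>)
      ultimately show ?thesis by (simp add: p)
    next
      case True
      then obtain i where i: "i < length p" "p ! ((i + 1) mod length p) = rv (p ! i)"
        using nc less.prems \<open>p \<noteq> []\<close> hd unfolding has_circuit_def by blast
      define e where "e = p ! i"
      have e: "e \<in> E" "rv e \<in> E" "rv e \<noteq> e" "org (rv e) = t e" "t (rv e) = org e"
        using less.prems i G serre_graph_t_rv[OF G, of e]
        by (auto simp: e_def serre_graph_def)
      \<comment> \<open>In a closed walk with one edge the cyclic successor of \<open>e\<close> is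
        \<open>e\<close> itself, which would give \<open>rv e = e\<close>.\<close>
      have len: "length p \<noteq> 1"
        using i e by (auto simp: e_def)
      show ?thesis
      proof (cases "i + 1 < length p")
        case True
        define a b where "a = take i p" and "b = drop (i + 2) p"
        have p: "p = a @ [e, rv e] @ b"
          using True i by (metis Suc_eq_plus1 add_2_eq_Suc' append_Cons append_Nil a_def b_def e_def Cons_nth_drop_Suc append_take_drop_id mod_less)
        have "sum_list (map \<chi> (a @ b)) = 0"
        proof (rule less.hyps)
          show "walk org t (a @ b) x x"
            using less.prems e by (auto simp: p walk_append)
        qed (use less.prems in \<open>auto simp: p\<close>)
        then show ?thesis using anti[OF e(1)] by (simp add: p)
      next
        \<comment> \<open>The backtrack wraps around the end: \<open>p\<close> starts with
          \<open>rv e\<close> and ends with \<open>e\<close>, and what remains is closed at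
          \<open>org e\<close> instead of \<open>x\<close>.\<close>
        case False
        then have last: "i = length p - 1" using i by auto
        then have "hd p = rv e" "last p = e"
          using i \<open>p \<noteq> []\<close> by (auto simp: e_def hd_conv_nth last_conv_nth)
        then obtain q where p: "p = rv e # q @ [e]"
          using len \<open>p \<noteq> []\<close> by (cases p rule: list.exhaust; cases "tl p" rule: rev_exhaust) auto
        have "sum_list (map \<chi> q) = 0"
        proof (rule less.hyps)
          show "walk org t q (org e) (org e)"
            using less.prems e by (auto simp: p walk_append)
        qed (use less.prems in \<open>auto simp: p\<close>)
        then show ?thesis using anti[OF e(1)] by (simp add: p)
      qed
    qed
  qed auto
qed

lemma walk_rev:
  assumes "serre_graph V E org t rv" "p \<in> lists E" "walk org t p x y"
  shows "walk org t (rev (map rv p)) y x"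
  using assms(2-)
proof (induction p arbitrary: x)
  case (Cons e p)
  then have "org (rv e) = t e" "t (rv e) = x"
    using assms(1) serre_graph_t_rv[OF assms(1), of e] by (auto simp: serre_graph_def)
  then show ?case using Cons by (auto simp: walk_append)
qed auto

text \<open>Integrate \<open>\<chi>\<close> along chosen walks from a base vertex. Going out to
  \<open>org e\<close>, across \<open>e\<close> and back from \<open>t e\<close> is a closed walk,
  so its sum vanishes.\<close>

lemma tree_potential:
  fixes \<chi> :: "'e \<Rightarrow> int"
  assumes T: "serre_tree V E org t rv"
    and anti: "\<And>e. e \<in> E \<Longrightarrow> \<chi> (rv e) = - \<chi> e"
  shows "\<exists>\<phi> :: 'v \<Rightarrow> int. \<forall>e\<in>E. \<phi> (t e) - \<phi> (org e) = \<chi> e"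
proof -
  have G: "serre_graph V E org t rv" and nc: "\<not> has_circuit E org t rv"
    and conn: "serre_connected V E org t"
    using T by (auto simp: serre_tree_def)
  obtain x0 where x0: "x0 \<in> V" using conn by (auto simp: serre_connected_def)
  have "\<forall>x\<in>V. \<exists>p. p \<in> lists E \<and> walk org t p x0 x"
    using conn x0 by (auto simp: serre_connected_def Bex_def)
  then obtain P where P: "\<And>x. x \<in> V \<Longrightarrow> P x \<in> lists E" "\<And>x. x \<in> V \<Longrightarrow> walk org t (P x) x0 x"
    by metis
  have "sum_list (map \<chi> (P (t e))) - sum_list (map \<chi> (P (org e))) = \<chi> e" if e: "e \<in> E" for e
  proof -
    let ?q = "P (org e) @ [e] @ rev (map rv (P (t e)))"
    have v: "org e \<in> V" "t e \<in> V" using G e by (auto simp: serre_graph_def)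
    have "walk org t (rev (map rv (P (t e)))) (t e) x0"
      using walk_rev[OF G P(1,2)[OF v(2)]] .
    then have "walk org t ?q x0 x0"
      using P(2)[OF v(1)] by (auto simp: walk_append)
    moreover have "?q \<in> lists E"
      using P(1)[OF v(1)] P(1)[OF v(2)] e G by (auto simp: serre_graph_def in_lists_conv_set)
    ultimately have "sum_list (map \<chi> ?q) = 0"
      by (intro closed_walk_sum_zero[OF G nc, where x = x0] anti)
    moreover have "sum_list (map \<chi> (rev (map rv p))) = - sum_list (map \<chi> p)" if "p \<in> lists E" for p
      using that by (induction p) (auto simp: anti)
    ultimately show ?thesis using P(1)[OF v(2)] by simp
  qed
  then show ?thesis by (intro exI[of _ "\<lambda>v. sum_list (map \<chi> (P v))"] ballI)
qed

text \<open>A circuit with first edge \<open>x\<close> contains \<open>x\<close> only once because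
  its origins are distinct. It cannot contain \<open>rv x\<close>, whose origin is that of the
  second edge: this would repeat an origin or backtrack. So the jumps add up to 1, although a closed
  walk has total 0.\<close>

lemma no_circuit_if_potentials:
  fixes V :: "'v set"
  assumes G: "serre_graph V E org t rv"
    and pot: "\<And>x. x \<in> E \<Longrightarrow> \<exists>\<phi> :: 'v \<Rightarrow> int. \<forall>y\<in>E. \<phi> (t y) - \<phi> (org y) = of_bool (y = x) - of_bool (y = rv x)"
  shows "\<not> has_circuit E org t rv"
proof
  assume "has_circuit E org t rv"
  then obtain p where p: "p \<noteq> []" "p \<in> lists E" "walk org t p (org (hd p)) (org (hd p))"
      "distinct (map org p)" "\<And>i. i < length p \<Longrightarrow> p ! ((i + 1) mod length p) \<noteq> rv (p ! i)"
    unfolding has_circuit_def by blast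
  obtain x q where xq: "p = x # q" using p(1) by (cases p) auto
  have x: "x \<in> E" "rv x \<noteq> x" "org (rv x) = t x" using p(2) G by (auto simp: xq serre_graph_def)
  obtain \<phi> :: "'v \<Rightarrow> int" where \<phi>: "\<forall>y\<in>E. \<phi> (t y) - \<phi> (org y) = of_bool (y = x) - of_bool (y = rv x)"
    using pot[OF x(1)] by blast
  let ?\<chi> = "\<lambda>y. of_bool (y = x) - of_bool (y = rv x) :: int"
  have "sum_list (map ?\<chi> p) = 0"
    using walk_sum_diff[OF p(3), of \<phi> ?\<chi>] \<phi> p(2) by (auto simp: in_lists_conv_set)
  moreover have "x \<notin> set q" using p(4) by (auto simp: xq)
  moreover have "rv x \<notin> set q"
  proof
    assume r: "rv x \<in> set q"
    then obtain y q' where q: "q = y # q'" by (cases q) auto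
    have "org y = t x" using p(3) by (auto simp: xq q)
    moreover have "y \<noteq> rv x" using p(5)[of 0] by (auto simp: xq q)
    ultimately show False using p(4) r x(3) by (force simp: xq q)
  qed
  moreover have "sum_list (map ?\<chi> q) = 0" if "x \<notin> set q" "rv x \<notin> set q" for q
    using that by (induction q) auto
  ultimately show False using x(2) by (auto simp: xq)
qed

text \<open>The edge \<open>f\<close> is the last exit from \<open>A\<close>; the remainder of the
  walk stays outside.\<close>

lemma walk_last_exit:
  assumes "walk org t p a b" "p \<in> lists E" "a \<in> A" "b \<notin> A"
  obtains f q where "f \<in> E" "org f \<in> A" "q \<in> lists E" "walk org t q (t f) b" "t f \<notin> A"
    "\<And>g. g \<in> set q \<Longrightarrow> org g \<notin> A \<and> t g \<notin> A"
proof -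
  \<comment> \<open>The premise is weakened so that the induction passes to tails that start outside
    \<open>A\<close> but meet it later.\<close>
  have "\<exists>f q. f \<in> E \<and> org f \<in> A \<and> q \<in> lists E \<and> walk org t q (t f) b \<and> t f \<notin> A \<and>
      (\<forall>g\<in>set q. org g \<notin> A \<and> t g \<notin> A)"
    if "a \<in> A \<or> (\<exists>e\<in>set p. org e \<in> A \<or> t e \<in> A)"
    using that assms(1,2,4)
  proof (induction p arbitrary: a)
    case (Cons e p)
    show ?case
    proof (cases "t e \<in> A \<or> (\<exists>e\<in>set p. org e \<in> A \<or> t e \<in> A)")
      case True
      then show ?thesis using Cons.IH[of "t e"] Cons.prems by auto
    next
      case False
      then have "org e \<in> A" using Cons.prems by auto
      then show ?thesis using False Cons.prems by (intro exI[of _ e] exI[of _ p]) auto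
    qed
  qed auto
  then show thesis using assms(3) that by blast
qed

section \<open>Words and presentations\<close>

lemma wprod_Nil [simp]: "wprod G [] = \<one>\<^bsub>G\<^esub>"
  by (simp add: wprod_def)

lemma wprod_Cons [simp]: "wprod G (x # ws) = x \<otimes>\<^bsub>G\<^esub> wprod G ws"
  by (simp add: wprod_def)

context group
begin

lemma wprod_closed: "ws \<in> lists (carrier G) \<Longrightarrow> wprod G ws \<in> carrier G"
  by (induction ws) auto

lemma wprod_append:
  "us \<in> lists (carrier G) \<Longrightarrow> vs \<in> lists (carrier G) \<Longrightarrow>
   wprod G (us @ vs) = wprod G us \<otimes> wprod G vs"
  by (induction us) (auto simp: m_assoc wprod_closed)

lemma generateI_wprod:
  assumes "J \<subseteq> carrier G" "ws \<in> lists J"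
  shows "wprod G ws \<in> generate G J"
  using assms(2) by (induction ws) (auto intro: generate.intros)

lemma generate_mult_cancel:
  assumes "J \<subseteq> carrier G" "h \<in> generate G J" "g \<in> carrier G"
  shows "h \<otimes> g \<in> generate G J \<longleftrightarrow> g \<in> generate G J"
  using assms generate_is_subgroup[OF assms(1)]
  by (metis generate.eng generate_in_carrier generate_m_inv_closed inv_solve_left' m_closed)

lemma conj_eq_iff:
  assumes "x \<in> carrier G" "s \<in> carrier G" "r \<in> carrier G" "s \<otimes> s = \<one>"
  shows "s \<otimes> x \<otimes> s = r \<longleftrightarrow> x = s \<otimes> r \<otimes> s"
  using assms by (metis inv_equality inv_solve_left' inv_solve_right' m_assoc m_closed)

end

lemma pres_eq_context:
  assumes "pres_eq X R a b" "u \<in> lists X" "v \<in> lists X"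
  shows "pres_eq X R (u @ a @ v) (u @ b @ v)"
  using assms(1)
proof (induction rule: pres_eq.induct)
  case (refl w)
  then show ?case using assms by (intro pres_eq.refl) auto
next
  case (rel l r u' v')
  then show ?case using assms pres_eq.rel[of l r R "u @ u'" X "v' @ v"] by simp
qed (blast intro: pres_eq.sym pres_eq.trans)+

lemma pres_eq_in_lists:
  assumes "pres_eq X R a b" "\<And>l r. (l, r) \<in> R \<Longrightarrow> l \<in> lists X \<and> r \<in> lists X"
  shows "a \<in> lists X \<and> b \<in> lists X"
  using assms(1) by (induction rule: pres_eq.induct) (use assms(2) in auto)

lemma pres_eq_append:
  assumes "pres_eq X R a b" "pres_eq X R c d"
    and "\<And>l r. (l, r) \<in> R \<Longrightarrow> l \<in> lists X \<and> r \<in> lists X"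
  shows "pres_eq X R (a @ c) (b @ d)"
proof -
  have "a \<in> lists X" "b \<in> lists X" "c \<in> lists X" "d \<in> lists X"
    using pres_eq_in_lists[OF assms(1,3)] pres_eq_in_lists[OF assms(2,3)] by auto
  then show ?thesis
    using pres_eq_context[OF assms(1), of "[]" c] pres_eq_context[OF assms(2), of b "[]"]
    by (auto intro: pres_eq.trans)
qed

section \<open>Coxeter groups\<close>

text \<open>For a word \<open>s\<^sub>1 \<dots> s\<^sub>n\<close> this lists the reflections
  \<open>s\<^sub>1 \<dots> s\<^sub>i \<dots> s\<^sub>1\<close>, which are the walls crossed by the gallery of that type
  starting at the identity.\<close>
fun refl_seq :: "('a, 'b) monoid_scheme \<Rightarrow> 'a list \<Rightarrow> 'a list" where
  "refl_seq G [] = []"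
| "refl_seq G (s # ws) = s # map (\<lambda>r. s \<otimes>\<^bsub>G\<^esub> r \<otimes>\<^bsub>G\<^esub> s) (refl_seq G ws)"

lemma length_refl_seq [simp]: "length (refl_seq G ws) = length ws"
  by (induction ws) auto

lemma alternating_in_lists: "x \<in> J \<Longrightarrow> y \<in> J \<Longrightarrow> concat (replicate k [x, y]) \<in> lists J"
  by (induction k) auto

locale coxeter_group = group W for W (structure) +
  fixes S :: "'a set" and m :: "'a \<Rightarrow> 'a \<Rightarrow> nat"
  assumes S_carrier: "S \<subseteq> carrier W"
    and S_generates: "w \<in> carrier W \<Longrightarrow> \<exists>ws\<in>lists S. wprod W ws = w"
    and matrix: "coxeter_matrix S m"
    and wprod_eq_one_iff: "ws \<in> lists S \<Longrightarrow> wprod W ws = \<one> \<longleftrightarrow> pres_eq S (coxeter_relators S m) ws []"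

lemma coxeter_system_imp_coxeter_group:
  assumes "coxeter_system W S"
  shows "\<exists>m. coxeter_group W S m"
  using assms by (auto simp: coxeter_system_def coxeter_group_def coxeter_group_axioms_def)

context coxeter_group
begin

lemma S_closed: "s \<in> S \<Longrightarrow> s \<in> carrier W"
  using S_carrier by auto

lemma subset_carrier: "J \<subseteq> S \<Longrightarrow> J \<subseteq> carrier W"
  using S_carrier by auto

lemma lists_carrier: "J \<subseteq> S \<Longrightarrow> ws \<in> lists J \<Longrightarrow> ws \<in> lists (carrier W)"
  using S_carrier by auto

lemma relators_in_lists: "(l, r) \<in> coxeter_relators S m \<Longrightarrow> l \<in> lists S \<and> r \<in> lists S"
  by (auto simp: coxeter_relators_def)

lemma wprod_alternating:
  "s \<in> carrier W \<Longrightarrow> t \<in> carrier W \<Longrightarrow> wprod W (concat (replicate k [s, t])) = (s \<otimes> t) [^] k"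
proof (induction k)
  case (Suc k)
  then have "wprod W (concat (replicate (Suc k) [s, t])) = (s \<otimes> t) \<otimes> (s \<otimes> t) [^] k"
    by (simp add: m_assoc)
  also have "\<dots> = (s \<otimes> t) [^] Suc k"
    using Suc.prems by (intro nat_pow_Suc2[symmetric]) auto
  finally show ?case .
qed auto

lemma relator_one:
  assumes "s \<in> S" "t \<in> S" "m s t \<noteq> 0"
  shows "(s \<otimes> t) [^] m s t = \<one>"
proof -
  have r: "(concat (replicate (m s t) [s, t]), []) \<in> coxeter_relators S m"
    using assms by (auto simp: coxeter_relators_def)
  then have "pres_eq S (coxeter_relators S m) (concat (replicate (m s t) [s, t])) []"
    using pres_eq.rel[OF r, of "[]" S "[]"] by simp
  then show ?thesis
    using wprod_eq_one_iff relators_in_lists[OF r] wprod_alternating assms S_closed by metis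
qed

lemma S_square: "s \<in> S \<Longrightarrow> s \<otimes> s = \<one>"
  using relator_one[of s s] matrix S_closed by (simp add: coxeter_matrix_def)

lemma S_inv: "s \<in> S \<Longrightarrow> inv s = s"
  using S_square S_closed by (simp add: inv_equality)

lemma S_cancel: "s \<in> S \<Longrightarrow> w \<in> carrier W \<Longrightarrow> s \<otimes> (s \<otimes> w) = w"
  using S_square S_closed by (simp flip: m_assoc)

lemma wprod_rev: "ws \<in> lists S \<Longrightarrow> wprod W (rev ws) = inv (wprod W ws)"
proof (induction ws)
  case (Cons s ws)
  then have "s \<in> S" "s \<in> carrier W" "ws \<in> lists (carrier W)" "rev ws \<in> lists (carrier W)"
    using S_closed lists_carrier[of S ws] by auto
  then show ?case
    using Cons S_inv by (simp add: wprod_append wprod_closed inv_mult_group)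
qed auto

text \<open>The generators are involutions, so words without formal inverses exhaust the
  subgroup.\<close>

lemma generate_eq_wprod:
  assumes J: "J \<subseteq> S"
  shows "g \<in> generate W J \<longleftrightarrow> (\<exists>ws\<in>lists J. wprod W ws = g)"
proof
  assume "g \<in> generate W J"
  then show "\<exists>ws\<in>lists J. wprod W ws = g"
  proof (induction rule: generate.induct)
    case one
    show ?case by (intro bexI[of _ "[]"]) auto
  next
    case (incl h)
    then show ?case using J S_closed by (intro bexI[of _ "[h]"]) auto
  next
    case (inv h)
    then show ?case using J S_closed S_inv by (intro bexI[of _ "[h]"]) auto
  next
    case (eng h1 h2)
    then obtain us vs where "us \<in> lists J" "vs \<in> lists J" "wprod W us = h1" "wprod W vs = h2"
      by blast
    then show ?case
      using lists_carrier[OF J] by (intro bexI[of _ "us @ vs"]) (auto simp: wprod_append)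
  qed
qed (use generateI_wprod subset_carrier[OF J] in blast)

text \<open>Every Coxeter relator has even length, so the sign of a word is well defined.\<close>

lemma even_length_iff:
  assumes "pres_eq S (coxeter_relators S m) us vs"
  shows "even (length us) \<longleftrightarrow> even (length vs)"
  using assms
proof (induction rule: pres_eq.induct)
  case (rel l r u v)
  have "even (length (concat (replicate k [s, t])))" for k and s t :: 'a by (induction k) auto
  then show ?case using rel by (auto simp: coxeter_relators_def)
qed auto

lemma wprod_odd_neq_one: "ws \<in> lists S \<Longrightarrow> odd (length ws) \<Longrightarrow> wprod W ws \<noteq> \<one>"
  using wprod_eq_one_iff even_length_iff by fastforce

section \<open>Walls crossed by a word and their parity\<close>

lemma refl_seq_in_generate:
  "J \<subseteq> S \<Longrightarrow> ws \<in> lists J \<Longrightarrow> set (refl_seq W ws) \<subseteq> generate W J"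
  by (induction ws) (auto intro: generate.intros)

lemma refl_seq_closed: "ws \<in> lists S \<Longrightarrow> set (refl_seq W ws) \<subseteq> carrier W"
  using refl_seq_in_generate[of S ws] generate_in_carrier[OF S_carrier] by blast

lemma count_map_conj:
  assumes "s \<in> S" "r \<in> carrier W" "set xs \<subseteq> carrier W"
  shows "count_list (map (\<lambda>x. s \<otimes> x \<otimes> s) xs) r = count_list xs (s \<otimes> r \<otimes> s)"
  using assms(3)
proof (induction xs)
  case (Cons x xs)
  then show ?case
    using conj_eq_iff[of x s r] assms S_closed S_square by auto
qed auto

text \<open>The second part of the gallery starts at \<open>wprod W us\<close>, so its walls are
  those of \<open>vs\<close> conjugated by this element. Counting \<open>r\<close> there means
  counting in \<open>vs\<close> the conjugate of \<open>r\<close> moved back to the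
  identity.\<close>

lemma count_refl_seq_append:
  assumes "us \<in> lists S" "vs \<in> lists S" "r \<in> carrier W"
  shows "count_list (refl_seq W (us @ vs)) r =
    count_list (refl_seq W us) r + count_list (refl_seq W vs) (inv (wprod W us) \<otimes> r \<otimes> wprod W us)"
  using assms(1,3)
proof (induction us arbitrary: r rule: list.induct)
  case (Cons s us)
  have s: "s \<in> S" "s \<in> carrier W" and us: "us \<in> lists S" "wprod W us \<in> carrier W"
    using Cons.prems S_closed lists_carrier[of S us] wprod_closed by auto
  have *: "set (refl_seq W (us @ vs)) \<subseteq> carrier W" "set (refl_seq W us) \<subseteq> carrier W"
    using us assms(2) by (intro refl_seq_closed; auto)+
  have "inv (wprod W (s # us)) \<otimes> r \<otimes> wprod W (s # us) =
      inv (wprod W us) \<otimes> (s \<otimes> r \<otimes> s) \<otimes> wprod W us"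
    using s us Cons.prems S_inv by (simp add: inv_mult_group m_assoc)
  moreover have "count_list (x # xs) r = count_list xs r + of_bool (x = r)" for x xs
    by simp
  ultimately show ?case
    using Cons.IH[OF us(1), of "s \<otimes> r \<otimes> s"] s Cons.prems *
    by (simp add: count_map_conj del: count_list.simps)
qed (simp add: assms)

text \<open>These are reflections of a dihedral group in their order along the gallery; once a power
  of \<open>s \<otimes> t\<close> is trivial, the list is periodic.\<close>

lemma refl_seq_alternating:
  assumes "s \<in> S" "t \<in> S"
  shows "refl_seq W (concat (replicate k [s, t])) = map (\<lambda>j. (s \<otimes> t) [^] (j::nat) \<otimes> s) [0..<2 * k]"
proof (induction k)
  case (Suc k)
  have c: "s \<in> carrier W" "t \<in> carrier W" using assms S_closed by auto
  have step: "s \<otimes> (t \<otimes> ((s \<otimes> t) [^] j \<otimes> s) \<otimes> t) \<otimes> s = (s \<otimes> t) [^] (Suc (Suc j)) \<otimes> s" for j :: nat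
  proof -
    have "(s \<otimes> t) [^] (Suc (Suc j)) \<otimes> s = (s \<otimes> t) \<otimes> (s \<otimes> t) [^] j \<otimes> (s \<otimes> t) \<otimes> s"
      using c by (metis m_closed nat_pow_Suc nat_pow_Suc2)
    then show ?thesis using c by (simp add: m_assoc)
  qed
  have "refl_seq W (concat (replicate (Suc k) [s, t])) =
      [s, s \<otimes> t \<otimes> s] @ map (\<lambda>j. (s \<otimes> t) [^] (Suc (Suc j)) \<otimes> s) [0..<2 * k]"
    by (simp add: Suc step o_def del: nat_pow_Suc)
  also have "\<dots> = map (\<lambda>j. (s \<otimes> t) [^] (j::nat) \<otimes> s) ([0, 1] @ map (\<lambda>j. Suc (Suc j)) [0..<2 * k])"
    using c by (simp add: o_def)
  also have "[0, 1] @ map (\<lambda>j. Suc (Suc j)) [0..<2 * k] = [0..<2 * Suc k]"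
    by (rule nth_equalityI) (auto simp: nth_append nth_Cons' not_less)
  finally show ?case .
qed auto

text \<open>Inserting a relator changes each crossing count by an even number, since the second half
  of its list of walls repeats the first.\<close>

lemma pres_eq_invariants:
  assumes "pres_eq S (coxeter_relators S m) us vs"
  shows "wprod W us = wprod W vs \<and>
    (\<forall>r\<in>carrier W. even (count_list (refl_seq W us) r) \<longleftrightarrow> even (count_list (refl_seq W vs) r))"
  using assms
proof (induction rule: pres_eq.induct)
  case (rel l r u v)
  then obtain s t where l: "l = concat (replicate (m s t) [s, t])" and r: "r = []"
      and st: "s \<in> S" "t \<in> S" "m s t \<noteq> 0"
    by (auto simp: coxeter_relators_def)
  have c: "s \<in> carrier W" "t \<in> carrier W" using st S_closed by auto
  have one: "wprod W l = \<one>"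
    using relator_one st c by (simp add: l wprod_alternating)
  \<comment> \<open>Shifting the exponent by \<open>m s t\<close> does not change the power, so both
    halves give the same reflections.\<close>
  have "[0..<2 * m s t] = [0..<m s t] @ map (\<lambda>j. j + m s t) [0..<m s t]"
    using upt_add_eq_append[of 0 "m s t" "m s t"] map_add_upt[of "m s t" "m s t"] by (simp only: mult_2 le0 add_0)
  then have "refl_seq W l = map (\<lambda>j. (s \<otimes> t) [^] j \<otimes> s) [0..<m s t] @ map (\<lambda>j. (s \<otimes> t) [^] j \<otimes> s) [0..<m s t]"
    using relator_one[OF st] c by (simp add: l refl_seq_alternating[OF st(1,2)] o_def flip: nat_pow_mult)
  then have even: "even (count_list (refl_seq W l) x)" for x by simp
  have lS: "l \<in> lists S" using rel relators_in_lists by blast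
  note L = lists_carrier[OF subset_refl]
  have *: "wprod W (l @ v) = wprod W v"
    using one rel lS L by (simp add: wprod_append wprod_closed)
  have "even (count_list (refl_seq W (u @ l @ v)) x) = even (count_list (refl_seq W (u @ v)) x)"
    if x: "x \<in> carrier W" for x
  proof -
    have u: "wprod W u \<in> carrier W" using rel L wprod_closed by blast
    have "count_list (refl_seq W (u @ l @ v)) x = count_list (refl_seq W u) x +
        (count_list (refl_seq W l) (inv (wprod W u) \<otimes> x \<otimes> wprod W u) +
         count_list (refl_seq W v) (inv (wprod W u) \<otimes> x \<otimes> wprod W u))"
      using rel lS x u by (simp add: count_refl_seq_append one)
    then show ?thesis using even rel x by (simp add: count_refl_seq_append)
  qed
  then show ?case using * rel L lS by (simp add: r wprod_append)
qed auto

text \<open>The locale assumption only recognises words for the identity. Here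
  \<open>us @ rev vs @ vs\<close> is cancelled in two ways, to \<open>vs\<close> and to
  \<open>us\<close>.\<close>

lemma pres_eq_if_wprod_eq:
  assumes "us \<in> lists S" "vs \<in> lists S" "wprod W us = wprod W vs"
  shows "pres_eq S (coxeter_relators S m) us vs"
proof -
  let ?R = "coxeter_relators S m"
  have c: "rev vs \<in> lists S" "wprod W vs \<in> carrier W" "us \<in> lists (carrier W)" "vs \<in> lists (carrier W)"
      "rev vs \<in> lists (carrier W)"
    using assms lists_carrier[of S us] lists_carrier[of S vs] wprod_closed[of vs] by auto
  have "pres_eq S ?R (us @ rev vs) []" "pres_eq S ?R (rev vs @ vs) []"
    using assms c by (auto simp: wprod_append wprod_rev simp flip: wprod_eq_one_iff)
  then have "pres_eq S ?R (us @ rev vs @ vs) vs" "pres_eq S ?R (us @ rev vs @ vs) us"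
    using pres_eq_context[of S ?R "us @ rev vs" "[]" "[]" vs]
      pres_eq_context[of S ?R "rev vs @ vs" "[]" us "[]"] assms by auto
  then show ?thesis by (blast intro: pres_eq.sym pres_eq.trans)
qed

section \<open>Reduced words: exchange, deletion and special subgroups\<close>

lemma refl_seq_set_eq:
  assumes "us \<in> lists S" "vs \<in> lists S" "wprod W us = wprod W vs"
    and "distinct (refl_seq W us)" "distinct (refl_seq W vs)"
  shows "set (refl_seq W us) = set (refl_seq W vs)"
proof -
  \<comment> \<open>In a list without repetitions the parity of the count records membership, so the
    parity invariant determines the set of walls.\<close>
  have d: "even (count_list xs x) \<longleftrightarrow> x \<notin> set xs" if "distinct xs" for xs and x :: 'a
    using that by (induction xs) auto
  show ?thesis
    using pres_eq_invariants[OF pres_eq_if_wprod_eq[OF assms(1-3)]] assms(4,5)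
      refl_seq_closed[OF assms(1)] refl_seq_closed[OF assms(2)] d by blast
qed

text \<open>Left multiplication by a reflection listed in \<open>refl_seq\<close> deletes the letter
  at its position; the induction moves the reflection past the leading letter.\<close>

lemma exchange:
  assumes J: "J \<subseteq> S"
  shows "ws \<in> lists J \<Longrightarrow> r \<in> set (refl_seq W ws) \<Longrightarrow>
    \<exists>us\<in>lists J. length us < length ws \<and> wprod W us = r \<otimes> wprod W ws"
proof (induction ws arbitrary: r)
  case (Cons s ws)
  have s: "s \<in> J" "s \<in> S" "s \<in> carrier W" and ws: "ws \<in> lists J" "wprod W ws \<in> carrier W"
    using Cons.prems J S_closed lists_carrier[OF J, of ws] wprod_closed by auto
  show ?case
  proof (cases "r = s")
    case True
    then show ?thesis using ws s by (intro bexI[of _ ws]) (auto simp: S_cancel)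
  next
    case False
    then obtain r' where r': "r' \<in> set (refl_seq W ws)" "r = s \<otimes> r' \<otimes> s"
      using Cons.prems by auto
    then obtain us where us: "us \<in> lists J" "length us < length ws" "wprod W us = r' \<otimes> wprod W ws"
      using Cons.IH ws by blast
    have "r' \<in> carrier W" using refl_seq_closed[of ws] r' ws J by auto
    then show ?thesis using us s ws r'
      by (intro bexI[of _ "s # us"]) (auto simp: m_assoc S_cancel)
  qed
qed auto

text \<open>If the tail already repeats a wall, it can be shortened. Otherwise the repeated wall is
  that of the leading \<open>s\<close>; the tail itself crosses it, and exchange in the tail absorbs
  \<open>s\<close>.\<close>

lemma deletion:
  assumes J: "J \<subseteq> S"
  shows "ws \<in> lists J \<Longrightarrow> \<not> distinct (refl_seq W ws) \<Longrightarrow>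
    \<exists>us\<in>lists J. length us < length ws \<and> wprod W us = wprod W ws"
proof (induction ws)
  case (Cons s ws)
  have s: "s \<in> J" "s \<in> S" "s \<in> carrier W" and ws: "ws \<in> lists J" "wprod W ws \<in> carrier W"
    using Cons.prems J S_closed lists_carrier[OF J, of ws] wprod_closed by auto
  show ?case
  proof (cases "distinct (refl_seq W ws)")
    case True
    have c: "set (refl_seq W ws) \<subseteq> carrier W" using refl_seq_closed[of ws] ws J by auto
    have "inj_on (\<lambda>r. s \<otimes> r \<otimes> s) (set (refl_seq W ws))"
      using c s by (intro inj_onI) (metis m_closed right_cancel Units_eq Units_l_cancel subsetD)
    then have "s \<in> set (map (\<lambda>r. s \<otimes> r \<otimes> s) (refl_seq W ws))"
      using Cons.prems True by (auto simp: distinct_map)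
    then obtain r where r: "r \<in> set (refl_seq W ws)" "s \<otimes> r \<otimes> s = s" by auto
    then have "r = s"
      using conj_eq_iff[of r s s] c s by (auto simp: S_square)
    then obtain us where "us \<in> lists J" "length us < length ws" "wprod W us = s \<otimes> wprod W ws"
      using exchange[OF J ws(1)] r by blast
    then show ?thesis by (intro bexI[of _ us]) auto
  next
    case False
    then obtain us where "us \<in> lists J" "length us < length ws" "wprod W us = wprod W ws"
      using Cons by auto
    then show ?thesis using s by (intro bexI[of _ "s # us"]) auto
  qed
qed auto

text \<open>A shortest word over \<open>J\<close> cannot be shortened by deletion within
  \<open>J\<close>. Distinctness of \<open>refl_seq\<close> is the form in which reducedness is used
  below.\<close>

lemma reduced_word_exists:
  assumes J: "J \<subseteq> S" and g: "g \<in> generate W J"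
  obtains ws where "ws \<in> lists J" "wprod W ws = g" "distinct (refl_seq W ws)"
proof -
  let ?P = "\<lambda>ws. ws \<in> lists J \<and> wprod W ws = g"
  obtain ws where "?P ws" "\<And>us. ?P us \<Longrightarrow> length ws \<le> length us"
    using ex_has_least_nat[of ?P _ length] g generate_eq_wprod[OF J] by blast
  then show thesis using deletion[OF J] that by (metis not_less)
qed

text \<open>A reduced word for \<open>s\<close> over \<open>J\<close> crosses the same walls as the
  word \<open>[s]\<close>, hence exactly one, so it is a single letter.\<close>

lemma generate_Int_S:
  assumes J: "J \<subseteq> S" and s: "s \<in> S" "s \<in> generate W J"
  shows "s \<in> J"
proof -
  obtain ws where ws: "ws \<in> lists J" "wprod W ws = s" "distinct (refl_seq W ws)"
    using reduced_word_exists[OF J s(2)] .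
  have "set (refl_seq W ws) = set (refl_seq W [s])"
    using ws J s S_closed by (intro refl_seq_set_eq) auto
  then have "length ws = 1"
    using distinct_card[OF ws(3)] by simp
  then obtain a where "ws = [a]" by (cases ws) auto
  then show ?thesis using ws J S_closed by auto
qed

text \<open>Reduced words of \<open>g\<close> over \<open>J\<close> and over \<open>K\<close> cross
  the same walls. The first letter of a nonempty word over \<open>J\<close> is its first wall, so it
  lies in the group of \<open>K\<close> and thus in \<open>K\<close>, against disjointness.\<close>

lemma generate_disjoint:
  assumes J: "J \<subseteq> S" and K: "K \<subseteq> S" and JK: "J \<inter> K = {}"
    and g: "g \<in> generate W J" "g \<in> generate W K"
  shows "g = \<one>"
proof -
  obtain us where us: "us \<in> lists J" "wprod W us = g" "distinct (refl_seq W us)"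
    using reduced_word_exists[OF J g(1)] .
  obtain vs where vs: "vs \<in> lists K" "wprod W vs = g" "distinct (refl_seq W vs)"
    using reduced_word_exists[OF K g(2)] .
  have eq: "set (refl_seq W us) = set (refl_seq W vs)"
    using us vs J K by (intro refl_seq_set_eq) auto
  show ?thesis
  proof (cases us)
    case (Cons a us')
    then have "a \<in> generate W K"
      using eq refl_seq_in_generate[OF K vs(1)] by auto
    then have "a \<in> K" using generate_Int_S[OF K] us J Cons by auto
    then show ?thesis using us JK Cons by auto
  qed (use us in auto)
qed

end

section \<open>Residue graphs of buildings\<close>

locale special_graph = coxeter_group W S m for W (structure) and S :: "'a set" and m +
  fixes C :: "'c set" and \<delta> :: "'c \<Rightarrow> 'c \<Rightarrow> 'a"
    and V :: "'v set" and E :: "'e set" and org t :: "'e \<Rightarrow> 'v" and rv :: "'e \<Rightarrow> 'e"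
    and SV :: "'v \<Rightarrow> 'a set" and SE :: "'e \<Rightarrow> 'a set"
  assumes bld: "building W S C \<delta>"
    and gos: "graph_of_special_subgroups W S V E org t rv SV SE"
begin

abbreviation "Res J c \<equiv> residue W C \<delta> J c"
abbreviation "RV \<equiv> res_graph_V W C \<delta> V SV"
abbreviation "RE \<equiv> res_graph_E W C \<delta> E SE"
abbreviation "Ro \<equiv> res_graph_o W C \<delta> org SV"
abbreviation "Rt \<equiv> res_graph_o W C \<delta> t SV"

lemma base_graph: "serre_graph V E org t rv" and base_connected: "serre_connected V E org t"
  using gos by (auto simp: graph_of_special_subgroups_def)

lemma edge:
  assumes "e \<in> E"
  shows "org e \<in> V" "t e \<in> V" "rv e \<in> E" "rv (rv e) = e" "rv e \<noteq> e" "org (rv e) = t e"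
    "t (rv e) = org e"
  using assms base_graph serre_graph_t_rv[OF base_graph assms] by (auto simp: serre_graph_def)

lemma SV_S: "v \<in> V \<Longrightarrow> SV v \<subseteq> S"
  using gos by (auto simp: graph_of_special_subgroups_def)

lemma SE:
  assumes "e \<in> E"
  shows "SE e \<subseteq> S" "SE (rv e) = SE e" "SE e \<subseteq> SV (t e)" "SE e \<subseteq> SV (org e)"
proof -
  have "e \<in> E \<Longrightarrow> SE e \<subseteq> S \<and> SE (rv e) = SE e \<and> SE e \<subseteq> SV (t e)" for e
    using gos by (auto simp: graph_of_special_subgroups_def)
  from this[OF assms] this[OF edge(3)[OF assms]]
  show "SE e \<subseteq> S" "SE (rv e) = SE e" "SE e \<subseteq> SV (t e)" "SE e \<subseteq> SV (org e)"
    using edge[OF assms] by auto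
qed

section \<open>Weyl distance and residues\<close>

lemma chambers_nonempty: "C \<noteq> {}"
  using bld unfolding building_def by (elim conjE)

lemma delta_closed: "c \<in> C \<Longrightarrow> d \<in> C \<Longrightarrow> \<delta> c d \<in> carrier W"
  using bld unfolding building_def by (elim conjE) blast

lemma delta_one_iff: "c \<in> C \<Longrightarrow> d \<in> C \<Longrightarrow> \<delta> c d = \<one> \<longleftrightarrow> c = d"
  using bld unfolding building_def by (elim conjE) blast

lemma delta_adjacent:
  assumes "c \<in> C" "d \<in> C" "c' \<in> C" "\<delta> c' c \<in> S"
  shows "\<delta> c' d = \<delta> c' c \<otimes> \<delta> c d \<or> \<delta> c' d = \<delta> c d"
proof -
  have "\<forall>c\<in>C. \<forall>d\<in>C. \<forall>c'\<in>C. \<forall>s\<in>S. \<delta> c' c = s \<longrightarrow>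
      (\<delta> c' d = s \<otimes> \<delta> c d \<or> \<delta> c' d = \<delta> c d) \<and>
      (cox_length W S (s \<otimes> \<delta> c d) = cox_length W S (\<delta> c d) + 1
         \<longrightarrow> \<delta> c' d = s \<otimes> \<delta> c d)"
    using bld unfolding building_def by (elim conjE)
  then show ?thesis using assms by blast
qed

lemma delta_step:
  assumes "c \<in> C" "d \<in> C" "s \<in> S"
  obtains c' where "c' \<in> C" "\<delta> c' c = s" "\<delta> c' d = s \<otimes> \<delta> c d"
proof -
  have "\<forall>c\<in>C. \<forall>d\<in>C. \<forall>s\<in>S. \<exists>c'\<in>C. \<delta> c' c = s \<and> \<delta> c' d = s \<otimes> \<delta> c d"
    using bld unfolding building_def by (elim conjE)
  then show thesis using assms that by blast
qed

text \<open>Move from \<open>c'\<close> towards \<open>c\<close> along a word over \<open>J\<close>: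
  each step to an adjacent chamber changes the distance to \<open>d\<close> by at most a left factor
  in \<open>J\<close>.\<close>

lemma delta_coset:
  assumes J: "J \<subseteq> S" and "\<delta> c' c \<in> generate W J" and C: "c \<in> C" "d \<in> C" "c' \<in> C"
  shows "\<exists>g\<in>generate W J. \<delta> c' d = g \<otimes> \<delta> c d"
proof -
  obtain ws where "ws \<in> lists J" "wprod W ws = \<delta> c' c"
    using assms generate_eq_wprod[OF J] by blast
  then show ?thesis using C(3)
  proof (induction ws arbitrary: c' rule: list.induct)
    case Nil
    then have "c' = c" using delta_one_iff C by auto
    then show ?case using C delta_closed by (intro bexI[of _ \<one>]) (auto intro: generate.one)
  next
    case (Cons s ws)
    have s: "s \<in> J" "s \<in> S" "s \<in> carrier W" and ws: "ws \<in> lists J" "wprod W ws \<in> carrier W"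
      using Cons.prems J S_closed lists_carrier[OF J, of ws] wprod_closed by auto
    \<comment> \<open>The new chamber strips the first letter: its distance to \<open>c\<close> is
      spelled by \<open>ws\<close>.\<close>
    obtain c'' where c'': "c'' \<in> C" "\<delta> c'' c' = s" "\<delta> c'' c = s \<otimes> \<delta> c' c"
      using delta_step[OF Cons.prems(3) C(1) s(2)] .
    have "wprod W ws = \<delta> c'' c"
      using c'' Cons.prems s ws by (simp add: S_cancel flip: Cons.prems(2))
    then obtain g where g: "g \<in> generate W J" "\<delta> c'' d = g \<otimes> \<delta> c d"
      using Cons.IH c'' ws by blast
    have gc: "g \<in> carrier W" using g generate_in_carrier subset_carrier[OF J] by blast
    have "\<delta> c'' d = s \<otimes> \<delta> c' d \<or> \<delta> c'' d = \<delta> c' d"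
      using delta_adjacent[of c' d c''] c'' C Cons.prems s by auto
    then show ?case
    proof
      assume "\<delta> c'' d = s \<otimes> \<delta> c' d"
      then have "\<delta> c' d = s \<otimes> (g \<otimes> \<delta> c d)"
        using g S_cancel[OF s(2) delta_closed[OF Cons.prems(3) C(2)]] by simp
      then have "\<delta> c' d = (s \<otimes> g) \<otimes> \<delta> c d"
        using s gc delta_closed C by (simp add: m_assoc)
      then show ?thesis using g s by (blast intro: generate.eng generate.incl)
    qed (use g in metis)
  qed
qed

text \<open>With \<open>d = c'\<close> this yields the symmetry, and in general the transitivity, of
  lying in a common \<open>J\<close>-residue.\<close>

lemma delta_coset_cancel:
  assumes J: "J \<subseteq> S" and "\<delta> c' c \<in> generate W J" "c \<in> C" "d \<in> C" "c' \<in> C"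
  shows "\<delta> c' d \<in> generate W J \<longleftrightarrow> \<delta> c d \<in> generate W J"
  using delta_coset[OF assms] generate_mult_cancel[OF subset_carrier[OF J]] delta_closed assms by auto

lemma delta_refl: "c \<in> C \<Longrightarrow> \<delta> c c \<in> generate W J"
  using delta_one_iff[of c c] by (auto intro: generate.one)

lemma residue_eq_iff:
  assumes "J \<subseteq> S" "c \<in> C" "d \<in> C"
  shows "Res J c = Res J d \<longleftrightarrow> \<delta> c d \<in> generate W J"
proof
  assume "Res J c = Res J d"
  then show "\<delta> c d \<in> generate W J"
    using assms delta_refl[of d J] by (auto simp: residue_def set_eq_iff)
qed (use assms delta_coset_cancel[of J c d] in \<open>auto simp: residue_def\<close>)

text \<open>Makes maps that pick a chamber with \<open>SOME\<close> well defined: every pick from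
  the \<open>J\<close>-residue has the same \<open>K\<close>-residue, since the group of
  \<open>J\<close> lies in that of \<open>K\<close>.\<close>

lemma residue_some:
  assumes "J \<subseteq> K" "K \<subseteq> S" "c \<in> C"
  defines "d \<equiv> SOME d. d \<in> Res J c"
  shows "d \<in> C" "\<delta> c d \<in> generate W K" "Res K d = Res K c"
proof -
  have "d \<in> Res J c"
    unfolding d_def by (rule someI[of _ c]) (use assms(3) delta_refl[of c J] in \<open>auto simp: residue_def\<close>)
  then show "d \<in> C" "\<delta> c d \<in> generate W K"
    using mono_generate[OF assms(1)] by (auto simp: residue_def)
  then show "Res K d = Res K c"
    using residue_eq_iff[of K c d] assms(2,3) by simp
qed

lemma res_graph_o_eq:
  assumes "e \<in> E" "c \<in> C"
  shows "Ro (e, Res (SE e) c) = (org e, Res (SV (org e)) c)"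
    and "Rt (e, Res (SE e) c) = (t e, Res (SV (t e)) c)"
  using residue_some(3)[OF SE(4)[OF assms(1)] SV_S assms(2)]
    residue_some(3)[OF SE(3)[OF assms(1)] SV_S assms(2)] edge[OF assms(1)]
  by (auto simp: res_graph_o_def)

lemma res_graph_rev_eq:
  "e \<in> E \<Longrightarrow> res_graph_rev rv (e, Res (SE e) c) = (rv e, Res (SE (rv e)) c)"
  by (simp add: res_graph_rev_def SE)

section \<open>Incidence and connectedness of the residue graph\<close>

lemma RV_iff: "x \<in> RV \<longleftrightarrow> (\<exists>v c. v \<in> V \<and> c \<in> C \<and> x = (v, Res (SV v) c))"
  by (auto simp: res_graph_V_def)

lemma RV_I: "v \<in> V \<Longrightarrow> c \<in> C \<Longrightarrow> (v, Res (SV v) c) \<in> RV"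
  by (auto simp: res_graph_V_def)

lemma RE_I: "e \<in> E \<Longrightarrow> c \<in> C \<Longrightarrow> (e, Res (SE e) c) \<in> RE"
  by (auto simp: res_graph_E_def)

lemma RE_D: "x \<in> RE \<Longrightarrow> \<exists>e c. e \<in> E \<and> c \<in> C \<and> x = (e, Res (SE e) c)"
  by (auto simp: res_graph_E_def)

lemma res_graph_serre: "serre_graph RV RE Ro Rt (res_graph_rev rv)"
  unfolding serre_graph_def
proof
  fix x assume "x \<in> RE"
  then obtain e c where x: "e \<in> E" "c \<in> C" "x = (e, Res (SE e) c)" by (blast dest: RE_D)
  note e = edge[OF x(1)]
  have r: "res_graph_rev rv x = (rv e, Res (SE (rv e)) c)"
    unfolding x(3) by (rule res_graph_rev_eq[OF x(1)])
  have rr: "res_graph_rev rv (res_graph_rev rv x) = x"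
    using e(4) by (simp add: res_graph_rev_def x(3))
  have "Ro x = (org e, Res (SV (org e)) c)" "Rt x = (t e, Res (SV (t e)) c)"
    "Ro (res_graph_rev rv x) = (t e, Res (SV (t e)) c)"
    unfolding r unfolding x(3) using res_graph_o_eq[OF x(1,2)] res_graph_o_eq[OF e(3) x(2)] e(6) by auto
  then show "Ro x \<in> RV \<and> Rt x \<in> RV \<and> res_graph_rev rv x \<in> RE \<and>
      res_graph_rev rv (res_graph_rev rv x) = x \<and> res_graph_rev rv x \<noteq> x \<and>
      Ro (res_graph_rev rv x) = Rt x"
    using RV_I[OF e(1) x(2)] RV_I[OF e(2) x(2)] RE_I[OF e(3) x(2)] rr r e(5) x(3)
    by (metis fst_conv)
qed

text \<open>Each chamber \<open>c\<close> gives a copy of the base graph inside the residue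
  graph.\<close>

lemma res_walk_base:
  assumes "c \<in> C"
  shows "walk org t p u v \<Longrightarrow> p \<in> lists E \<Longrightarrow>
    walk Ro Rt (map (\<lambda>e. (e, Res (SE e) c)) p) (u, Res (SV u) c) (v, Res (SV v) c)"
  by (induction p arbitrary: u rule: list.induct) (auto simp: res_graph_o_eq assms)

text \<open>Copies of the connected base graph at chambers at distance \<open>s\<close> share the
  vertex over some \<open>v'\<close> with \<open>s \<in> SV v'\<close>, which exists by the
  covering. A word for \<open>\<delta> c d\<close> chains such copies.\<close>

lemma res_graph_connected:
  assumes S: "S = (\<Union>v\<in>V. SV v)"
  shows "serre_connected RV RE Ro Rt"
proof -
  have base: "\<exists>p\<in>lists RE. walk Ro Rt p (u, Res (SV u) c) (v, Res (SV v) c)"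
    if uv: "u \<in> V" "v \<in> V" and c: "c \<in> C" for u v c
  proof -
    obtain p where p: "p \<in> lists E" "walk org t p u v"
      using base_connected uv unfolding serre_connected_def by blast
    then have "map (\<lambda>e. (e, Res (SE e) c)) p \<in> lists RE"
      using c RE_I by auto
    then show ?thesis using res_walk_base[OF c p(2,1)] by blast
  qed
  have "\<exists>p\<in>lists RE. walk Ro Rt p (u, Res (SV u) c) (v, Res (SV v) d)"
    if uv: "u \<in> V" "v \<in> V" and d: "d \<in> C" and ws: "ws \<in> lists S" "c \<in> C" "wprod W ws = \<delta> c d"
    for u v c d ws
    using ws uv
  proof (induction ws arbitrary: c u rule: list.induct)
    case Nil
    then have "c = d" using delta_one_iff[of c d] d by auto
    then show ?case using base Nil.prems d by blast
  next
    case (Cons s ws)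
    have s: "s \<in> S" "s \<in> carrier W" and w: "ws \<in> lists S" "wprod W ws \<in> carrier W"
      using Cons.prems S_closed lists_carrier[of S ws] wprod_closed by auto
    obtain v' where v': "v' \<in> V" "s \<in> SV v'" using s S by auto
    obtain c' where c': "c' \<in> C" "\<delta> c' c = s" "\<delta> c' d = s \<otimes> \<delta> c d"
      using delta_step[OF Cons.prems(2) d s(1)] .
    have "wprod W ws = \<delta> c' d"
      using c' Cons.prems s w by (simp add: S_cancel flip: Cons.prems(3))
    then obtain q where q: "q \<in> lists RE" "walk Ro Rt q (v', Res (SV v') c') (v, Res (SV v) d)"
      using Cons.IH[OF w(1) c'(1) _ v'(1) uv(2)] by blast
    obtain p where p: "p \<in> lists RE" "walk Ro Rt p (u, Res (SV u) c) (v', Res (SV v') c)"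
      using base[OF Cons.prems(4) v'(1) Cons.prems(2)] by blast
    have "Res (SV v') c' = Res (SV v') c"
      using residue_eq_iff[OF SV_S[OF v'(1)] c'(1) Cons.prems(2)] c' v' by (auto intro: generate.incl)
    then show ?case using p q by (intro bexI[of _ "p @ q"]) (auto simp: walk_append)
  qed
  moreover have "\<exists>ws\<in>lists S. wprod W ws = \<delta> c d" if "c \<in> C" "d \<in> C" for c d
    using that S_generates delta_closed by auto
  ultimately have "\<exists>p\<in>lists RE. walk Ro Rt p x y" if "x \<in> RV" "y \<in> RV" for x y
    using that by (auto simp: RV_iff) blast
  moreover have "RV \<noteq> {}"
    using base_connected chambers_nonempty by (auto simp: serre_connected_def res_graph_V_def)
  ultimately show ?thesis by (auto simp: serre_connected_def)
qed

text \<open>A function on the vertices of the residue graph, written as a function of a base vertex and a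
  chamber, whose coboundary is supported on the residue of type \<open>SE e0\<close> of \<open>c0\<close>.\<close>
definition sep_potential :: "'e \<Rightarrow> 'c \<Rightarrow> ('v \<Rightarrow> 'c \<Rightarrow> int) \<Rightarrow> bool" where
  "sep_potential e0 c0 h \<longleftrightarrow>
    (\<forall>v\<in>V. \<forall>c\<in>C. \<forall>d\<in>C. \<delta> c d \<in> generate W (SV v) \<longrightarrow> h v c = h v d) \<and>
    (\<forall>e\<in>E. \<forall>c\<in>C. h (t e) c - h (org e) c =
       (of_bool (e = e0) - of_bool (e = rv e0)) * of_bool (\<delta> c c0 \<in> generate W (SE e0)))"

section \<open>Trees and separating potentials\<close>

lemma res_edge_eq_iff:
  assumes "e0 \<in> E" "c0 \<in> C" "e \<in> E" "c \<in> C"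
  shows "(e, Res (SE e) c) = (e0, Res (SE e0) c0) \<longleftrightarrow> e = e0 \<and> \<delta> c c0 \<in> generate W (SE e0)"
    and "(e, Res (SE e) c) = (rv e0, Res (SE (rv e0)) c0) \<longleftrightarrow>
      e = rv e0 \<and> \<delta> c c0 \<in> generate W (SE e0)"
  using assms residue_eq_iff[of "SE e0" c c0] SE(1,2)[OF assms(1)] by auto

text \<open>Take the potential of the signed indicator of the edge and read it as a function of base
  vertex and chamber.\<close>

lemma res_tree_imp_sep_potential:
  assumes tree: "serre_tree RV RE Ro Rt (res_graph_rev rv)" and e0: "e0 \<in> E" and c0: "c0 \<in> C"
  shows "\<exists>h. sep_potential e0 c0 h"
proof -
  define x where "x = (e0, Res (SE e0) c0)"
  have rx: "res_graph_rev rv x = (rv e0, Res (SE (rv e0)) c0)"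
    using e0 by (simp add: x_def res_graph_rev_eq)
  let ?\<chi> = "\<lambda>y. of_bool (y = x) - of_bool (y = res_graph_rev rv x) :: int"
  have xE: "x \<in> RE" using e0 c0 RE_I by (simp add: x_def)
  have inv: "res_graph_rev rv (res_graph_rev rv y) = y" if "y \<in> RE" for y
    using res_graph_serre that by (auto simp: serre_graph_def)
  have "?\<chi> (res_graph_rev rv y) = - ?\<chi> y" if "y \<in> RE" for y
  proof -
    have "res_graph_rev rv y = x \<longleftrightarrow> y = res_graph_rev rv x"
        "res_graph_rev rv y = res_graph_rev rv x \<longleftrightarrow> y = x"
      using inv[OF that] inv[OF xE] by metis+
    then show ?thesis by simp
  qed
  then obtain \<phi> :: "'v \<times> 'c set \<Rightarrow> int" where \<phi>: "\<And>y. y \<in> RE \<Longrightarrow> \<phi> (Rt y) - \<phi> (Ro y) = ?\<chi> y"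
    using tree_potential[OF tree, of ?\<chi>] by blast
  define h where "h v c = \<phi> (v, Res (SV v) c)" for v c
  have "h (t e) c - h (org e) c =
      (of_bool (e = e0) - of_bool (e = rv e0)) * of_bool (\<delta> c c0 \<in> generate W (SE e0))"
    if e: "e \<in> E" and c: "c \<in> C" for e c
  proof -
    have "(e, Res (SE e) c) \<in> RE" using e c by (rule RE_I)
    from \<phi>[OF this] show ?thesis
      using res_edge_eq_iff[OF e0 c0 e c] unfolding rx unfolding x_def h_def
      by (simp add: res_graph_o_eq[OF e c])
  qed
  moreover have "h v c = h v d" if "v \<in> V" "c \<in> C" "d \<in> C" "\<delta> c d \<in> generate W (SV v)" for v c d
    using residue_eq_iff[OF SV_S[OF that(1)] that(2,3)] that(4) by (simp add: h_def)
  ultimately have "sep_potential e0 c0 h" unfolding sep_potential_def by blast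
  then show ?thesis by blast
qed

text \<open>Being constant on residues, \<open>h\<close> descends to the vertices of the residue
  graph, where it jumps only across one edge and its reverse.\<close>

lemma sep_potentials_imp_no_circuit:
  assumes "\<And>e0 c0. e0 \<in> E \<Longrightarrow> c0 \<in> C \<Longrightarrow> \<exists>h. sep_potential e0 c0 h"
  shows "\<not> has_circuit RE Ro Rt (res_graph_rev rv)"
proof (rule no_circuit_if_potentials[OF res_graph_serre])
  fix x assume "x \<in> RE"
  then obtain e0 c0 where x: "e0 \<in> E" "c0 \<in> C" "x = (e0, Res (SE e0) c0)" by (blast dest: RE_D)
  then obtain h where h: "sep_potential e0 c0 h" using assms by blast
  define \<phi> where "\<phi> = (\<lambda>(v, R). h v (SOME c. c \<in> R))"
  have \<phi>: "\<phi> (v, Res (SV v) c) = h v c" if "v \<in> V" "c \<in> C" for v c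
    using residue_some[OF subset_refl SV_S[OF that(1)] that(2)] h that
    unfolding sep_potential_def \<phi>_def by (metis case_prod_conv)
  have "\<phi> (Rt y) - \<phi> (Ro y) = of_bool (y = x) - of_bool (y = res_graph_rev rv x)" if yE: "y \<in> RE" for y
  proof -
    obtain e c where y: "e \<in> E" "c \<in> C" "y = (e, Res (SE e) c)" using RE_D[OF yE] by blast
    show ?thesis
      using h y edge[OF y(1)] res_edge_eq_iff[OF x(1,2) y(1,2)]
      unfolding x(3) y(3) res_graph_rev_eq[OF x(1)] sep_potential_def
      by (simp add: res_graph_o_eq \<phi>)
  qed
  then show "\<exists>\<phi> :: 'v \<times> 'c set \<Rightarrow> int. \<forall>y\<in>RE. \<phi> (Rt y) - \<phi> (Ro y) =
      of_bool (y = x) - of_bool (y = res_graph_rev rv x)" by blast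
qed

end

section \<open>From a visual decomposition to a tree\<close>

text \<open>A word in the generators spells a walk in the residue graph of \<open>W\<close> which leaves the base
  point at the chamber \<open>w\<close>. With \<open>n v w\<close> the signed number of crossings of a fixed edge on the way to
  the vertex \<open>v\<close> inside the copy of the maximal tree at \<open>w\<close>, and \<open>h e w\<close> that of the loop through
  \<open>e\<close>, this is the signed number of crossings along the whole walk.\<close>
fun word_val :: "('a, 'b) monoid_scheme \<Rightarrow> ('v \<Rightarrow> 'a \<Rightarrow> int) \<Rightarrow> ('e \<Rightarrow> 'a \<Rightarrow> int) \<Rightarrow> 'a \<Rightarrow>
    ('v, 'e, 'a) gog_letter list \<Rightarrow> int" where
  "word_val G n h w [] = 0"
| "word_val G n h w (VL v g # u) = n v w - n v (w \<otimes>\<^bsub>G\<^esub> g) + word_val G n h (w \<otimes>\<^bsub>G\<^esub> g) u"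
| "word_val G n h w (EL e # u) = h e w + word_val G n h w u"

context special_graph
begin

abbreviation "X \<equiv> gog_gens W V E SV"
abbreviation "ev u \<equiv> wprod W (map (gog_eval W) u)"
abbreviation "rels T \<equiv> gog_relations W V E org t rv SV SE T"

section \<open>Words in the fundamental group of the graph of groups\<close>

lemma VL_in_gens: "v \<in> V \<Longrightarrow> g \<in> generate W (SV v) \<Longrightarrow> VL v g \<in> X"
  by (simp add: gog_gens_def)

lemma EL_in_gens: "e \<in> E \<Longrightarrow> EL e \<in> X"
  by (simp add: gog_gens_def)

lemma gens_cases:
  assumes "x \<in> X"
  shows "(\<exists>v g. x = VL v g \<and> v \<in> V \<and> g \<in> generate W (SV v)) \<or> (\<exists>e. x = EL e \<and> e \<in> E)"
  using assms by (auto simp: gog_gens_def)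

lemma vertex_group_closed: "v \<in> V \<Longrightarrow> g \<in> generate W (SV v) \<Longrightarrow> g \<in> carrier W"
  using generate_in_carrier subset_carrier[OF SV_S] by blast

lemma edge_group:
  assumes "e \<in> E" "a \<in> generate W (SE e)"
  shows "a \<in> generate W (SV (t e))" "a \<in> generate W (SV (org e))" "a \<in> carrier W"
proof -
  show t: "a \<in> generate W (SV (t e))"
    using assms mono_generate[OF SE(3)] by blast
  show "a \<in> generate W (SV (org e))"
    using assms mono_generate[OF SE(4)] by blast
  show "a \<in> carrier W"
    using vertex_group_closed[OF _ t] edge assms by blast
qed

lemma gog_eval_closed: "x \<in> X \<Longrightarrow> gog_eval W x \<in> carrier W"
  using gens_cases[of x] vertex_group_closed by auto

lemma ev_lists: "u \<in> lists X \<Longrightarrow> map (gog_eval W) u \<in> lists (carrier W)"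
  using gog_eval_closed by auto

lemma ev_closed: "u \<in> lists X \<Longrightarrow> ev u \<in> carrier W"
  by (rule wprod_closed[OF ev_lists])

lemma ev_append: "u \<in> lists X \<Longrightarrow> v \<in> lists X \<Longrightarrow> ev (u @ v) = ev u \<otimes> ev v"
  using ev_lists by (simp add: wprod_append)

lemma rels_cases:
  assumes "(l, r) \<in> rels T"
  obtains (mult) v g h where "v \<in> V" "g \<in> generate W (SV v)" "h \<in> generate W (SV v)"
      "l = [VL v g, VL v h]" "r = [VL v (g \<otimes> h)]"
  | (one) v where "v \<in> V" "l = [VL v \<one>]" "r = []"
  | (rev) e where "e \<in> E" "l = [EL e, EL (rv e)]" "r = []"
  | (conj) e a where "e \<in> E" "a \<in> generate W (SE e)"
      "l = [EL e, VL (t e) a, EL (rv e)]" "r = [VL (org e) a]"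
  | (tree) e where "e \<in> T" "l = [EL e]" "r = []"
  using assms unfolding gog_relations_def by blast

lemma rels_in_lists:
  assumes "T \<subseteq> E" "(l, r) \<in> rels T"
  shows "l \<in> lists X \<and> r \<in> lists X"
  using assms(2)
proof (cases rule: rels_cases)
  case (mult v g h)
  then show ?thesis by (auto intro: VL_in_gens generate.eng)
next
  case (one v)
  then show ?thesis by (auto intro: VL_in_gens generate.one)
next
  case (rev e)
  then show ?thesis using edge[of e] by (auto intro: EL_in_gens)
next
  case (conj e a)
  then show ?thesis using edge[of e] edge_group[of e a] by (auto intro: EL_in_gens VL_in_gens)
next
  case (tree e)
  then show ?thesis using assms(1) by (auto intro: EL_in_gens)
qed

lemma rels_ev:
  assumes "T \<subseteq> E" "(l, r) \<in> rels T"
  shows "ev l = ev r"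
  using assms(2)
  by (cases rule: rels_cases) (auto simp: vertex_group_closed edge_group)

lemma word_val_append:
  assumes "v \<in> lists X"
  shows "u \<in> lists X \<Longrightarrow> w \<in> carrier W \<Longrightarrow>
    word_val W n h w (u @ v) = word_val W n h w u + word_val W n h (w \<otimes> ev u) v"
proof (induction u arbitrary: w rule: list.induct)
  case (Cons x u)
  have u: "u \<in> lists X" "ev u \<in> carrier W" "gog_eval W x \<in> carrier W"
    using Cons.prems ev_closed[of u] gog_eval_closed by auto
  show ?case
    using u Cons by (cases x) (auto simp: m_assoc)
qed simp

text \<open>Multiplication relators telescope in \<open>n\<close>; the assumptions on
  \<open>h\<close> treat the relators with edge letters. Both sides of a relation have the same
  value in \<open>W\<close>, so the rest of the word is read from the same start.\<close>

lemma pres_eq_word_val: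
  assumes T: "T \<subseteq> E"
    and rev: "\<And>e w. e \<in> E \<Longrightarrow> w \<in> carrier W \<Longrightarrow> h e w + h (rv e) w = 0"
    and conj: "\<And>e w a. e \<in> E \<Longrightarrow> w \<in> carrier W \<Longrightarrow> a \<in> generate W (SE e) \<Longrightarrow>
      h e w + (n (t e) w - n (t e) (w \<otimes> a)) + h (rv e) (w \<otimes> a) = n (org e) w - n (org e) (w \<otimes> a)"
    and tree: "\<And>e w. e \<in> T \<Longrightarrow> w \<in> carrier W \<Longrightarrow> h e w = 0"
    and eq: "pres_eq X (rels T) u u'" and w: "w \<in> carrier W"
  shows "word_val W n h w u = word_val W n h w u'"
  using eq w
proof (induction arbitrary: w rule: pres_eq.induct)
  case (rel l r u v)
  have lr: "l \<in> lists X" "r \<in> lists X" "ev l = ev r"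
    using rels_in_lists[OF T rel(1)] rels_ev[OF T rel(1)] by auto
  have "word_val W n h z l = word_val W n h z r" if z: "z \<in> carrier W" for z
    using rel(1)
  proof (cases rule: rels_cases)
    case (mult v g h)
    then show ?thesis using z by (simp add: vertex_group_closed m_assoc)
  next
    case (rev e)
    then show ?thesis using z assms(2) by simp
  next
    case (conj e a)
    then show ?thesis using z assms(3)[of e z a] by simp
  qed (use z tree in auto)
  then show ?case
    using lr rel ev_closed[of u] by (simp add: word_val_append)
qed auto

lemma visual_sep_potential:
  assumes vis: "visual_decomposition W S V E org t rv SV SE"
    and e0: "e0 \<in> E" and c0: "c0 \<in> C"
  shows "\<exists>h. sep_potential e0 c0 h"
proof -
  obtain T where T: "maximal_tree V E org t rv T"
    and surj: "\<And>w. w \<in> carrier W \<Longrightarrow> \<exists>u\<in>lists X. ev u = w"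
    and inj: "\<And>u u'. u \<in> lists X \<Longrightarrow> u' \<in> lists X \<Longrightarrow> ev u = ev u' \<Longrightarrow> pres_eq X (rels T) u u'"
    using vis unfolding visual_decomposition_def by blast
  have TE: "T \<subseteq> E" and tree: "serre_tree V T org t rv"
    using T by (auto simp: maximal_tree_def)
  define H where "H = generate W (SE e0)"
  have H: "subgroup H W" "H \<subseteq> carrier W"
    using generate_is_subgroup[OF subset_carrier[OF SE(1)[OF e0]]] by (auto simp: H_def subgroup.subset)
  \<comment> \<open>The signed crossing of the edge over \<open>e\<close>, in the copy of the base
    graph at \<open>w\<close>, with the fixed edge, which is the coset \<open>H\<close> over
    \<open>e0\<close>.\<close>
  define \<chi> :: "'e \<Rightarrow> 'a \<Rightarrow> int" where
    "\<chi> e w = (of_bool (e = e0) - of_bool (e = rv e0)) * of_bool (w \<in> H)" for e w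
  have \<chi>_rv: "\<chi> (rv e) w = - \<chi> e w" if "e \<in> E" for e w
  proof -
    have "rv e = e0 \<longleftrightarrow> e = rv e0" "rv e = rv e0 \<longleftrightarrow> e = e0"
      using edge[OF that] edge[OF e0] by metis+
    then show ?thesis by (simp add: \<chi>_def)
  qed
  have \<chi>_mult: "\<chi> e (w \<otimes> a) = \<chi> e w"
    if "e \<in> E" "w \<in> carrier W" "a \<in> generate W (SE e)" for e w a
  proof (cases "e = e0 \<or> e = rv e0")
    case True
    then have "a \<in> H" using that SE(2)[OF e0] by (auto simp: H_def)
    then have "w \<otimes> a \<in> H \<longleftrightarrow> w \<in> H"
      using H that by (metis subgroup.m_closed subgroup.m_inv_closed subsetD inv_solve_right' m_closed)
    then show ?thesis by (simp add: \<chi>_def)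
  qed (simp add: \<chi>_def)
  \<comment> \<open>For each \<open>w\<close> the potential on the maximal tree is determined on
    \<open>V\<close> up to a constant. In \<open>f\<close> below these constants cancel, except for
    the one at the identity.\<close>
  have "\<exists>\<phi>. \<forall>e\<in>T. \<phi> (t e) - \<phi> (org e) = \<chi> e w" for w
  proof -
    have "\<chi> (rv e) w = - \<chi> e w" if "e \<in> T" for e
      using \<chi>_rv TE that by blast
    then show ?thesis by (rule tree_potential[OF tree, of "\<lambda>e. \<chi> e w"])
  qed
  then obtain N where N: "\<And>w e. e \<in> T \<Longrightarrow> N w (t e) - N w (org e) = \<chi> e w"
    by metis
  define n where "n v w = N w v" for v w
  \<comment> \<open>Out to \<open>org e\<close> in the tree, across \<open>e\<close>, and back from
    \<open>t e\<close>.\<close>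
  define h where "h e w = n (org e) w + \<chi> e w - n (t e) w" for e w
  have val: "word_val W n h w u = word_val W n h w u'"
    if "u \<in> lists X" "u' \<in> lists X" "ev u = ev u'" "w \<in> carrier W" for u u' w
  proof (rule pres_eq_word_val[OF TE _ _ _ inj[OF that(1-3)] that(4)])
    show "h e w + h (rv e) w = 0" if "e \<in> E" for e w
      using that edge[OF that] by (simp add: h_def \<chi>_rv)
    show "h e w + (n (t e) w - n (t e) (w \<otimes> a)) + h (rv e) (w \<otimes> a) = n (org e) w - n (org e) (w \<otimes> a)"
      if "e \<in> E" "w \<in> carrier W" "a \<in> generate W (SE e)" for e w a
      using that edge[OF that(1)] by (simp add: h_def \<chi>_rv \<chi>_mult)
    show "h e w = 0" if "e \<in> T" for e w
      using N[OF that, of w] by (simp add: h_def n_def)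
  qed
  obtain U where U: "\<And>w. w \<in> carrier W \<Longrightarrow> U w \<in> lists X" "\<And>w. w \<in> carrier W \<Longrightarrow> ev (U w) = w"
    using surj by metis
  \<comment> \<open>Crossings on the way from the base point at the identity to the vertex over
    \<open>v\<close> at \<open>w\<close>; by \<open>val\<close> the choice of the word
    \<open>U w\<close> is immaterial.\<close>
  define f where "f v w = word_val W n h \<one> (U w) + n v w" for v w
  have f_mult: "f v (w \<otimes> g) = f v w" if "v \<in> V" "w \<in> carrier W" "g \<in> generate W (SV v)" for v w g
  proof -
    have g: "g \<in> carrier W" "[VL v g] \<in> lists X"
      using that vertex_group_closed VL_in_gens by auto
    have "ev (U w @ [VL v g]) = w \<otimes> g"
      using ev_append[OF U(1)[OF that(2)] g(2)] U(2)[OF that(2)] g by (simp del: map_append)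
    then have "word_val W n h \<one> (U (w \<otimes> g)) = word_val W n h \<one> (U w @ [VL v g])"
      using g that U[of w] U[of "w \<otimes> g"] by (intro val) (auto simp del: map_append)
    then show ?thesis
      using g U[of w] that by (simp add: f_def word_val_append)
  qed
  have f_edge: "f (t e) w - f (org e) w = \<chi> e w" if "e \<in> E" "w \<in> carrier W" for e w
  proof -
    have e: "[EL e] \<in> lists X" using that EL_in_gens by auto
    \<comment> \<open>The word \<open>[EL e]\<close> has the value of the empty word, so injectivity
      gives \<open>h e w = 0\<close> for every edge, on the tree or not.\<close>
    have "word_val W n h w [EL e] = word_val W n h w []"
      using e that by (intro val) auto
    then show ?thesis by (simp add: f_def h_def)
  qed
  \<comment> \<open>Moving \<open>c\<close> within a residue multiplies \<open>\<delta> c c0\<close>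
    on the left, whereas \<open>f\<close> is invariant on the right; hence the inverse.\<close>
  define k where "k v c = f v (inv (\<delta> c c0))" for v c
  have "k v c = k v d" if v: "v \<in> V" "c \<in> C" "d \<in> C" "\<delta> c d \<in> generate W (SV v)" for v c d
  proof -
    obtain g where g: "g \<in> generate W (SV v)" "\<delta> c c0 = g \<otimes> \<delta> d c0"
      using delta_coset[OF SV_S[OF v(1)] v(4,3) c0 v(2)] by blast
    have gc: "g \<in> carrier W" "inv g \<in> generate W (SV v)" "\<delta> d c0 \<in> carrier W"
      using g that vertex_group_closed generate_m_inv_closed[OF subset_carrier[OF SV_S[OF that(1)]]]
        delta_closed c0 by auto
    then show ?thesis
      using f_mult[OF that(1) _ gc(2), of "inv (\<delta> d c0)"] g by (simp add: k_def inv_mult_group)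
  qed
  moreover have "k (t e) c - k (org e) c =
      (of_bool (e = e0) - of_bool (e = rv e0)) * of_bool (\<delta> c c0 \<in> generate W (SE e0))"
    if "e \<in> E" "c \<in> C" for e c
  proof -
    have c: "\<delta> c c0 \<in> carrier W" using that c0 delta_closed by auto
    have "inv (\<delta> c c0) \<in> H \<longleftrightarrow> \<delta> c c0 \<in> H"
      using H(1) c by (metis inv_inv subgroup.m_inv_closed)
    then show ?thesis using f_edge[of e "inv (\<delta> c c0)"] that c by (simp add: k_def \<chi>_def H_def)
  qed
  ultimately have "sep_potential e0 c0 k" unfolding sep_potential_def by blast
  then show ?thesis by blast
qed

text \<open>All values of words lie in the special subgroup of the union, and by
  \<open>generate_Int_S\<close> an element of \<open>S\<close> in that subgroup is one of its
  generators.\<close>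

lemma visual_covers:
  assumes vis: "visual_decomposition W S V E org t rv SV SE"
  shows "S = (\<Union>v\<in>V. SV v)"
proof
  let ?J = "\<Union>v\<in>V. SV v"
  have J: "?J \<subseteq> S" using SV_S by blast
  have gen: "ev u \<in> generate W ?J" if "u \<in> lists X" for u
    using that
  proof (induction u rule: list.induct)
    case (Cons x u)
    have "gog_eval W x \<in> generate W ?J"
      using gens_cases[of x] Cons.prems mono_generate[of _ ?J]
      by (auto intro: generate.one) (meson UN_upper subsetD)
    then show ?case using Cons by (auto intro: generate.eng)
  qed (auto intro: generate.one)
  show "S \<subseteq> ?J"
  proof
    fix s assume s: "s \<in> S"
    then obtain u where "u \<in> lists X" "ev u = s"
      using vis S_closed unfolding visual_decomposition_def by blast
    then show "s \<in> ?J" using generate_Int_S[OF J s] gen by auto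
  qed
qed (use SV_S in blast)

lemma visual_imp_res_tree:
  assumes vis: "visual_decomposition W S V E org t rv SV SE"
  shows "serre_tree RV RE Ro Rt (res_graph_rev rv)"
  using res_graph_serre res_graph_connected[OF visual_covers[OF vis]]
    sep_potentials_imp_no_circuit[OF visual_sep_potential[OF vis]]
  by (simp add: serre_tree_def)

end

section \<open>From a tree to a visual decomposition\<close>

locale tree_special_graph = special_graph W S m C \<delta> V E org t rv SV SE
  for W (structure) and S :: "'a set" and m and C :: "'c set" and \<delta>
    and V :: "'v set" and E :: "'e set" and org t rv SV SE +
  assumes cover: "S = (\<Union>v\<in>V. SV v)"
    and tree: "serre_tree RV RE Ro Rt (res_graph_rev rv)"
begin

lemma S_letter_in_gens: "v \<in> V \<Longrightarrow> s \<in> SV v \<Longrightarrow> VL v s \<in> X"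
  by (rule VL_in_gens[OF _ generate.incl])

text \<open>At the chamber \<open>c\<close> itself the residue condition holds trivially, so
  \<open>h v c\<close> as a function of \<open>v\<close> separates the base graph at
  \<open>x\<close>.\<close>

lemma base_tree: "serre_tree V E org t rv"
proof -
  obtain c where c: "c \<in> C" using chambers_nonempty by blast
  have "\<not> has_circuit E org t rv"
  proof (rule no_circuit_if_potentials[OF base_graph])
    fix x assume x: "x \<in> E"
    obtain h where h: "sep_potential x c h"
      using res_tree_imp_sep_potential[OF tree x c] by blast
    have "h (t y) c - h (org y) c = of_bool (y = x) - of_bool (y = rv x)" if "y \<in> E" for y
      using h that c delta_refl[OF c] by (simp add: sep_potential_def)
    then show "\<exists>\<phi> :: 'v \<Rightarrow> int. \<forall>y\<in>E. \<phi> (t y) - \<phi> (org y) = of_bool (y = x) - of_bool (y = rv x)"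
      by (intro exI[of _ "\<lambda>v. h v c"]) blast
  qed
  then show ?thesis using base_graph base_connected by (simp add: serre_tree_def)
qed

text \<open>Across \<open>f\<close> the potential jumps by the indicator; along \<open>q\<close>,
  which avoids \<open>A\<close> and hence both \<open>f\<close> and \<open>rv f\<close>, it is
  constant.\<close>

lemma exit_edge_potential:
  assumes h: "sep_potential f c0 h" and f: "f \<in> E" "org f \<in> A"
    and q: "q \<in> lists E" "walk org t q (t f) b" "\<And>g. g \<in> set q \<Longrightarrow> org g \<notin> A \<and> t g \<notin> A"
    and c: "c \<in> C"
  shows "h b c - h (org f) c = of_bool (\<delta> c c0 \<in> generate W (SE f))"
proof -
  have hE: "h (t e) c - h (org e) c =
      (of_bool (e = f) - of_bool (e = rv f)) * of_bool (\<delta> c c0 \<in> generate W (SE f))"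
    if "e \<in> E" for e
    using h that c by (simp add: sep_potential_def)
  have zero: "h (t g) c - h (org g) c = 0" if "g \<in> set q" for g
  proof -
    have "g \<in> E" "g \<noteq> f" "g \<noteq> rv f"
      using q(1) q(3)[OF that] that f edge(7)[OF f(1)] by (auto simp: in_lists_conv_set)
    then show ?thesis using hE by simp
  qed
  have "sum_list (map (\<lambda>_. 0) q) = h b c - h (t f) c"
    by (rule walk_sum_diff[where \<phi> = "\<lambda>v. h v c", OF q(2) zero])
  moreover have "sum_list (map (\<lambda>_. 0 :: int) q) = 0" by (induction q) auto
  ultimately show ?thesis using hE[OF f(1)] edge(5)[OF f(1)] by simp
qed

text \<open>Otherwise an edge \<open>f\<close> without the label \<open>s\<close> leads out of the
  part \<open>A\<close> reachable from \<open>v\<close>. Between \<open>c0\<close> and a chamber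
  \<open>c\<close> at distance \<open>s\<close>, the potential agrees at \<open>org f\<close> and at
  \<open>v'\<close>; yet its difference between these vertices is 1 at \<open>c0\<close> and 0 at
  \<open>c\<close>.\<close>

lemma label_connected:
  assumes s: "s \<in> S" and v: "v \<in> V" "s \<in> SV v" and v': "v' \<in> V" "s \<in> SV v'"
  shows "\<exists>p\<in>lists {e\<in>E. s \<in> SE e}. walk org t p v v'"
proof (rule ccontr)
  assume no: "\<not> ?thesis"
  define A where "A = {u. \<exists>p\<in>lists {e\<in>E. s \<in> SE e}. walk org t p v u}"
  have "v \<in> A" unfolding A_def by (auto intro: bexI[of _ "[]"])
  moreover have "v' \<notin> A" using no by (auto simp: A_def)
  moreover obtain p where "p \<in> lists E" "walk org t p v v'"
    using base_connected v v' unfolding serre_connected_def by blast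
  ultimately obtain f q where f: "f \<in> E" "org f \<in> A" "t f \<notin> A"
      and q: "q \<in> lists E" "walk org t q (t f) v'" "\<And>g. g \<in> set q \<Longrightarrow> org g \<notin> A \<and> t g \<notin> A"
    using walk_last_exit[of org t p v v' E A] by metis
  have SA: "s \<in> SV u" if u: "u \<in> A" for u
  proof -
    obtain p where p: "p \<in> lists {e\<in>E. s \<in> SE e}" "walk org t p v u"
      using u by (auto simp: A_def)
    then show ?thesis using v(2)
    proof (induction p arbitrary: v rule: list.induct)
      case (Cons e p)
      then show ?case using SE(3)[of e] by auto
    qed auto
  qed
  have sf: "s \<notin> SE f"
  proof
    assume sf: "s \<in> SE f"
    obtain p where "p \<in> lists {e\<in>E. s \<in> SE e}" "walk org t p v (org f)"
      using f by (auto simp: A_def)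
    then have "p @ [f] \<in> lists {e\<in>E. s \<in> SE e}" "walk org t (p @ [f]) v (t f)"
      using f sf by (auto simp: walk_append)
    then show False using f(3) unfolding A_def by blast
  qed
  obtain c0 where c0: "c0 \<in> C" using chambers_nonempty by blast
  obtain c where c: "c \<in> C" "\<delta> c c0 = s"
    using delta_step[OF c0 c0 s] by metis
  obtain h where h: "sep_potential f c0 h"
    using res_tree_imp_sep_potential[OF tree f(1) c0] by blast
  have eq: "h u c = h u c0" if "u \<in> V" "s \<in> SV u" for u
    using h that c c0 unfolding sep_potential_def by (auto intro: generate.incl)
  have "h v' c0 - h (org f) c0 = 1"
    using exit_edge_potential[OF h f(1,2) q c0] delta_refl[OF c0] by simp
  moreover have "h v' c - h (org f) c = 0"
    using exit_edge_potential[OF h f(1,2) q c(1)] generate_Int_S[OF SE(1)[OF f(1)] s] sf c by auto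
  ultimately show False
    using eq[OF v'] eq[OF edge(1)[OF f(1)] SA[OF f(2)]] by simp
qed

text \<open>If no vertex group contains both \<open>s\<close> and \<open>s'\<close>, some edge \<open>f\<close> of the base separates the
  vertices carrying \<open>s\<close> from one carrying \<open>s'\<close>. A closed gallery of type \<open>(s s')\<^sup>m\<close> lifts to a
  closed walk which crosses the residue of \<open>f\<close> only in one direction.\<close>
lemma spherical_pair_covered:
  assumes s: "s \<in> S" and s': "s' \<in> S" and m: "m s s' \<noteq> 0"
  shows "\<exists>v\<in>V. s \<in> SV v \<and> s' \<in> SV v"
proof (rule ccontr)
  assume no: "\<not> ?thesis"
  obtain a b where a: "a \<in> V" "s \<in> SV a" and b: "b \<in> V" "s' \<in> SV b"
    using s s' cover by blast
  define A where "A = {v\<in>V. s \<in> SV v}"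
  have "a \<in> A" "b \<notin> A" using a b no by (auto simp: A_def)
  moreover obtain p where "p \<in> lists E" "walk org t p a b"
    using base_connected a b unfolding serre_connected_def by blast
  ultimately obtain f q where f: "f \<in> E" "org f \<in> A" "t f \<notin> A"
      and q: "q \<in> lists E" "walk org t q (t f) b" "\<And>g. g \<in> set q \<Longrightarrow> org g \<notin> A \<and> t g \<notin> A"
    using walk_last_exit[of org t p a b E A] by metis
  \<comment> \<open>The set \<open>SE f\<close> lies in the labels of both ends:
    \<open>org f\<close> carries \<open>s\<close> and hence not \<open>s'\<close>, while
    \<open>t f\<close> does not carry \<open>s\<close>.\<close>
  have disj: "SE f \<inter> {s, s'} = {}"
    using f SE(3,4)[OF f(1)] edge[OF f(1)] no by (auto simp: A_def)
  obtain c0 where c0: "c0 \<in> C" using chambers_nonempty by blast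
  obtain h where h: "sep_potential f c0 h"
    using res_tree_imp_sep_potential[OF tree f(1) c0] by blast
  have D: "h b c - h (org f) c = of_bool (\<delta> c c0 \<in> generate W (SE f))" if "c \<in> C" for c
    using exit_edge_potential[OF h f(1,2) q that] .
  have adj: "h v c = h v d" if "v \<in> V" "c \<in> C" "d \<in> C" "\<delta> c d \<in> SV v" for v c d
    using h that unfolding sep_potential_def by (auto intro: generate.incl)
  have cl: "s \<in> carrier W" "s' \<in> carrier W" using s s' S_closed by auto
  \<comment> \<open>The lifted walk passes to \<open>c'\<close> at \<open>b\<close> and to
    \<open>d\<close> at \<open>org f\<close>. Its outward crossing at \<open>c\<close> may count.
    The return at \<open>c'\<close> does not: \<open>\<delta> c' c0\<close> has a word of odd length
    in \<open>s, s'\<close>, so it is nontrivial and outside the group of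
    \<open>SE f\<close>.\<close>
  have step: "\<exists>d\<in>C. \<delta> d c0 = (s \<otimes> s') [^] Suc k \<and>
      h (org f) d = h (org f) c + of_bool (\<delta> c c0 \<in> generate W (SE f))"
    if c: "c \<in> C" "\<delta> c c0 = (s \<otimes> s') [^] k" for c k
  proof -
    obtain c' where c': "c' \<in> C" "\<delta> c' c = s'" "\<delta> c' c0 = s' \<otimes> \<delta> c c0"
      using delta_step[OF c(1) c0 s'] by metis
    obtain d where d: "d \<in> C" "\<delta> d c' = s" "\<delta> d c0 = s \<otimes> \<delta> c' c0"
      using delta_step[OF c'(1) c0 s] by metis
    let ?ws = "s' # concat (replicate k [s, s'])"
    have ws: "?ws \<in> lists {s, s'}" "wprod W ?ws = \<delta> c' c0"
      using c' c cl alternating_in_lists[of s "{s, s'}" s'] by (simp_all add: wprod_alternating)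
    have "odd (length ?ws)" by (induction k) auto
    then have "\<delta> c' c0 \<noteq> \<one>"
      using wprod_odd_neq_one[of ?ws] ws s s' by fastforce
    moreover have "\<delta> c' c0 \<in> generate W {s, s'}"
      using generateI_wprod[of "{s, s'}" ?ws] ws cl by auto
    ultimately have "\<delta> c' c0 \<notin> generate W (SE f)"
      using generate_disjoint[OF SE(1)[OF f(1)] _ disj] s s' by blast
    then have "h b c' = h (org f) c'" using D[OF c'(1)] by simp
    moreover have "h (org f) d = h (org f) c'"
      using f d c' by (intro adj) (auto simp: A_def)
    moreover have "h b c' = h b c"
      using b c c' by (intro adj) auto
    ultimately have "h (org f) d = h (org f) c + of_bool (\<delta> c c0 \<in> generate W (SE f))"
      using D[OF c(1)] by simp
    moreover have "\<delta> d c0 = (s \<otimes> s') [^] Suc k"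
      using d c' c cl nat_pow_Suc2[of "s \<otimes> s'" k] by (simp add: m_assoc del: nat_pow_Suc)
    ultimately show ?thesis using d by blast
  qed
  \<comment> \<open>The first crossing, at \<open>c0\<close>, contributes 1, and no later step
    decreases the value.\<close>
  have "\<exists>c\<in>C. \<delta> c c0 = (s \<otimes> s') [^] Suc k \<and> h (org f) c \<ge> h (org f) c0 + 1" for k
  proof (induction k)
    case 0
    have "\<delta> c0 c0 = (s \<otimes> s') [^] (0::nat)" using delta_one_iff[OF c0 c0] by simp
    from step[OF c0 this] show ?case
      using delta_refl[OF c0, of "SE f"] by fastforce
  next
    case (Suc k)
    then obtain c where c: "c \<in> C" "\<delta> c c0 = (s \<otimes> s') [^] Suc k" "h (org f) c \<ge> h (org f) c0 + 1"
      by blast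
    obtain d where d: "d \<in> C" "\<delta> d c0 = (s \<otimes> s') [^] Suc (Suc k)"
        "h (org f) d = h (org f) c + of_bool (\<delta> c c0 \<in> generate W (SE f))"
      using step[OF c(1,2)] by blast
    have "h (org f) d \<ge> h (org f) c0 + 1" using c(3) d(3) by simp
    then show ?case using d(1,2) by blast
  qed
  \<comment> \<open>For this \<open>k\<close> the exponent \<open>Suc k\<close> is
    \<open>m s s'\<close>, so the gallery closes up at \<open>c0\<close>, but with a larger value of
    \<open>h\<close>.\<close>
  from this[of "m s s' - 1"] obtain c where
    c: "c \<in> C" "\<delta> c c0 = (s \<otimes> s') [^] m s s'" "h (org f) c \<ge> h (org f) c0 + 1"
    using m by auto
  then have "c = c0" using relator_one[OF s s' m] delta_one_iff[OF c(1) c0] by simp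
  then show False using c by simp
qed

section \<open>The inverse homomorphism from the Coxeter group\<close>

abbreviation pi_eq (infix "\<approx>" 50) where "u \<approx> u' \<equiv> pres_eq X (rels E) u u'"

lemma pi_refl: "u \<in> lists X \<Longrightarrow> u \<approx> u"
  by (rule pres_eq.refl)

lemmas pi_sym = pres_eq.sym[of X "rels E"]
lemmas pi_trans [trans] = pres_eq.trans[of X "rels E"]

lemma pi_rel: "(l, r) \<in> rels E \<Longrightarrow> l \<approx> r"
  using pres_eq.rel[of l r "rels E" "[]" X "[]"] by simp

lemma pi_append: "a \<approx> b \<Longrightarrow> c \<approx> d \<Longrightarrow> a @ c \<approx> b @ d"
  using pres_eq_append[of X "rels E" a b c d] rels_in_lists[OF subset_refl] by blast

text \<open>The base graph is a tree, so \<open>E\<close> itself serves as the maximal tree and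
  every edge letter is trivial.\<close>

lemma pi_edge: "e \<in> E \<Longrightarrow> [EL e] \<approx> []"
  by (rule pi_rel) (auto simp: gog_relations_def)

lemma pi_one: "v \<in> V \<Longrightarrow> [VL v \<one>] \<approx> []"
  by (rule pi_rel) (auto simp: gog_relations_def)

lemma pi_mult:
  "v \<in> V \<Longrightarrow> g \<in> generate W (SV v) \<Longrightarrow> h \<in> generate W (SV v) \<Longrightarrow> [VL v g, VL v h] \<approx> [VL v (g \<otimes> h)]"
  by (rule pi_rel) (auto simp: gog_relations_def)

text \<open>With trivial edge letters the conjugation relation identifies the two copies of the edge
  group.\<close>

lemma pi_edge_conj:
  assumes e: "e \<in> E" and a: "a \<in> generate W (SE e)"
  shows "[VL (t e) a] \<approx> [VL (org e) a]"
proof -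
  have "[VL (t e) a] \<in> lists X"
    using e a edge(2) edge_group(1) VL_in_gens by auto
  then have "[EL e] @ [VL (t e) a] @ [EL (rv e)] \<approx> [] @ [VL (t e) a] @ []"
    using pi_edge[OF e] pi_edge[OF edge(3)[OF e]] by (intro pi_append pi_refl)
  moreover have "[EL e] @ [VL (t e) a] @ [EL (rv e)] \<approx> [VL (org e) a]"
    using e a by (intro pi_rel) (auto simp: gog_relations_def)
  ultimately show ?thesis by (auto intro: pi_sym pi_trans)
qed

text \<open>Carry \<open>s\<close> along a walk through edges whose label contains it; each edge
  identifies the copies at its ends.\<close>

lemma pi_vertex_independent:
  assumes s: "s \<in> S" and v: "v \<in> V" "s \<in> SV v" and v': "v' \<in> V" "s \<in> SV v'"
  shows "[VL v s] \<approx> [VL v' s]"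
proof -
  obtain p where "p \<in> lists {e\<in>E. s \<in> SE e}" "walk org t p v v'"
    using label_connected[OF assms] by blast
  then show ?thesis using v
  proof (induction p arbitrary: v rule: list.induct)
    case Nil
    then show ?case by (auto intro!: pi_refl S_letter_in_gens)
  next
    case (Cons e p)
    then have e: "e \<in> E" "s \<in> SE e" "org e = v" by auto
    have "[VL (t e) s] \<approx> [VL v' s]"
      using Cons e edge(2) SE(3)[OF e(1)] by auto
    moreover have "[VL (t e) s] \<approx> [VL v s]"
      using pi_edge_conj[OF e(1)] e by (auto intro: generate.incl)
    ultimately show ?case by (blast intro: pi_sym pi_trans)
  qed
qed

text \<open>An arbitrary choice, immaterial modulo \<open>\<approx>\<close> by
  \<open>pi_vertex_independent\<close>.\<close>

definition home :: "'a \<Rightarrow> 'v" where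
  "home s = (SOME v. v \<in> V \<and> s \<in> SV v)"

lemma home: "s \<in> S \<Longrightarrow> home s \<in> V \<and> s \<in> SV (home s)"
  unfolding home_def using cover by (intro someI_ex[of "\<lambda>v. v \<in> V \<and> s \<in> SV v"]) blast

abbreviation lift :: "'a list \<Rightarrow> ('v, 'e, 'a) gog_letter list" where
  "lift \<equiv> map (\<lambda>s. VL (home s) s)"

lemma lift_in_lists: "ws \<in> lists S \<Longrightarrow> lift ws \<in> lists X"
  using home S_letter_in_gens by auto

lemma ev_lift: "ev (lift ws) = wprod W ws"
  by (simp add: o_def)

text \<open>Move every letter to \<open>v\<close> and multiply there.\<close>

lemma pi_vertex_word:
  assumes v: "v \<in> V"
  shows "ws \<in> lists (SV v) \<Longrightarrow> lift ws \<approx> [VL v (wprod W ws)]"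
proof (induction ws rule: list.induct)
  case Nil
  then show ?case using pi_one[OF v] by (simp add: pi_sym)
next
  case (Cons s ws)
  have s: "s \<in> SV v" "s \<in> S" and ws: "ws \<in> lists (SV v)"
    using Cons.prems SV_S[OF v] by auto
  have "[VL (home s) s] @ lift ws \<approx> [VL v s] @ [VL v (wprod W ws)]"
    using pi_vertex_independent[OF s(2) _ _ v s(1)] home[OF s(2)] Cons.IH[OF ws] by (intro pi_append) auto
  also have "[VL v s] @ [VL v (wprod W ws)] \<approx> [VL v (s \<otimes> wprod W ws)]"
    using pi_mult[OF v generate.incl[OF s(1)]
        generateI_wprod[OF subset_carrier[OF SV_S[OF v]] ws]] by simp
  finally show ?case by simp
qed

text \<open>This makes \<open>lift\<close> well defined on \<open>W\<close>: the two letters of a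
  relator lie in a common vertex group, and there the relator multiplies to the identity.\<close>

lemma pi_lift:
  assumes "pres_eq S (coxeter_relators S m) us ws"
  shows "lift us \<approx> lift ws"
  using assms
proof (induction rule: pres_eq.induct)
  case (refl w)
  then show ?case by (intro pi_refl lift_in_lists)
next
  case (rel l r u v)
  then obtain s s' where l: "l = concat (replicate (m s s') [s, s'])" and r: "r = []"
      and ss: "s \<in> S" "s' \<in> S" "m s s' \<noteq> 0"
    by (auto simp: coxeter_relators_def)
  obtain x where x: "x \<in> V" "s \<in> SV x" "s' \<in> SV x"
    using spherical_pair_covered[OF ss] by blast
  have "lift l \<approx> [VL x (wprod W l)]"
    using x alternating_in_lists[of s "SV x" s'] by (intro pi_vertex_word) (simp_all add: l)
  also have "wprod W l = \<one>"
    using relator_one[OF ss] ss S_closed by (simp add: l wprod_alternating)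
  also have "[VL x \<one>] \<approx> []" by (rule pi_one[OF x(1)])
  finally have "lift l \<approx> []" .
  then have "lift u @ lift l @ lift v \<approx> lift u @ [] @ lift v"
    using rel by (intro pi_append pi_refl lift_in_lists)
  then show ?case by (simp add: r)
qed (blast intro: pi_sym pi_trans)+

text \<open>Shows that \<open>lift\<close> reaches every class: edge letters vanish, and elements of
  a vertex group are spelled by generators in \<open>SV v\<close>.\<close>

lemma pi_normal_form:
  assumes "u \<in> lists X"
  shows "\<exists>ws\<in>lists S. u \<approx> lift ws \<and> wprod W ws = ev u"
  using assms
proof (induction u rule: list.induct)
  case Nil
  then show ?case by (intro bexI[of _ "[]"]) (auto intro: pi_refl)
next
  case (Cons x u)
  then obtain ws where ws: "ws \<in> lists S" "u \<approx> lift ws" "wprod W ws = ev u" by auto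
  consider v g where "x = VL v g" "v \<in> V" "g \<in> generate W (SV v)" | e where "x = EL e" "e \<in> E"
    using gens_cases[of x] Cons.prems by auto
  then obtain us where us: "us \<in> lists S" "[x] \<approx> lift us" "wprod W us = gog_eval W x"
  proof cases
    case (1 v g)
    then obtain us where us: "us \<in> lists (SV v)" "wprod W us = g"
      using generate_eq_wprod[OF SV_S] by blast
    then show thesis
      using 1 pi_vertex_word[OF 1(2) us(1)] SV_S[OF 1(2)] by (intro that[of us]) (auto intro: pi_sym)
  next
    case (2 e)
    then show thesis using pi_edge by (intro that[of "[]"]) auto
  qed
  have "[x] @ u \<approx> lift us @ lift ws" using us ws by (intro pi_append)
  moreover have "wprod W (us @ ws) = ev (x # u)"
    using us ws lists_carrier[of S] by (simp add: wprod_append)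
  ultimately show ?case using us ws by (intro bexI[of _ "us @ ws"]) auto
qed

lemma visual: "visual_decomposition W S V E org t rv SV SE"
proof -
  have "maximal_tree V E org t rv E"
    using base_tree by (simp add: maximal_tree_def)
  moreover have "\<exists>u\<in>lists X. ev u = w" if "w \<in> carrier W" for w
    using S_generates[OF that] lift_in_lists ev_lift by blast
  moreover have "u \<approx> u'" if u: "u \<in> lists X" "u' \<in> lists X" "ev u = ev u'" for u u'
  proof -
    obtain ws where ws: "ws \<in> lists S" "u \<approx> lift ws" "wprod W ws = ev u"
      using pi_normal_form[OF u(1)] by blast
    obtain ws' where ws': "ws' \<in> lists S" "u' \<approx> lift ws'" "wprod W ws' = ev u'"
      using pi_normal_form[OF u(2)] by blast
    \<comment> \<open>Equal values in \<open>W\<close> make \<open>ws\<close> and \<open>ws'\<close>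
      congruent modulo the Coxeter relators, so their lifts agree.\<close>
    have "lift ws \<approx> lift ws'"
      using pres_eq_if_wprod_eq[OF ws(1) ws'(1)] ws(3) ws'(3) u(3) by (intro pi_lift) simp
    from pi_trans[OF ws(2) this] ws'(2) show ?thesis
      by (rule pi_trans[OF _ pi_sym])
  qed
  ultimately show ?thesis using gos unfolding visual_decomposition_def by blast
qed

end

theorem theorem5p9:
  fixes W :: "('a, 'b) monoid_scheme" and S :: "'a set"
    and C :: "'c set" and \<delta> :: "'c \<Rightarrow> 'c \<Rightarrow> 'a"
    and V :: "'v set" and E :: "'e set" and org t :: "'e \<Rightarrow> 'v" and rv :: "'e \<Rightarrow> 'e"
    and SV :: "'v \<Rightarrow> 'a set" and SE :: "'e \<Rightarrow> 'a set"
  assumes "coxeter_system W S"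
    and "building W S C \<delta>"
    and "graph_of_special_subgroups W S V E org t rv SV SE"
  shows "visual_decomposition W S V E org t rv SV SE \<longleftrightarrow>
    (S = (\<Union>v\<in>V. SV v) \<and>
     serre_tree (res_graph_V W C \<delta> V SV) (res_graph_E W C \<delta> E SE)
       (res_graph_o W C \<delta> org SV) (res_graph_o W C \<delta> t SV) (res_graph_rev rv))"
proof -
  obtain m where "coxeter_group W S m"
    using coxeter_system_imp_coxeter_group[OF assms(1)] by blast
  then have G: "special_graph W S m C \<delta> V E org t rv SV SE"
    using assms(2,3) by (simp add: special_graph_def special_graph_axioms_def)
  show ?thesis
    using special_graph.visual_covers[OF G] special_graph.visual_imp_res_tree[OF G]
      tree_special_graph.visual[of W S m C \<delta> V E org t rv SV SE] G
    unfolding tree_special_graph_def tree_special_graph_axioms_def by blast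
qed

end
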